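(* Let $(X,d)$ be a metric space and let $\Phi:X\to\mathbb R\cup\{+\infty\}$ be a proper functional bounded from below. Suppose that $\Phi$ is lower semicontinuous and that $\mathcal M(|\partial\Phi|)\neq\emptyset$, where $|\partial\Phi|$ is the global metric slope of $\Phi$. Let $u\in\mathcal M(|\partial\Phi|)$ and $\varepsilon>0$ be such that $$\Phi(u)\le\inf_X\Phi+\varepsilon.$$ Then for any $\lambda>0$ there exists $\hat u\in\mathcal M(|\partial\Phi|)$ such that (a) $d(u,\hat u)\le\lambda$; (b) $\Phi(\hat u)+\frac{\varepsilon}{\lambda}d(u,\hat u)\le\Phi(u)$; (c) $\Phi(\hat u)\le\Phi(v)+\frac{\varepsilon}{\lambda}d(v,\hat u)$ for all $v\in X$.
   Context: Notation: $\operatorname{dom}\Phi=\{u\in X:\Phi(u)<+\infty\}$; proper means $\operatorname{dom}\Phi\ne\emptyset$. The metric space is not assumed complete. Global metric slope: for $u\in\operatorname{dom}\Phi$, $|\partial\Phi|(u):=\max\left\{\sup_{v\in X\setminus\{u\}}\frac{\Phi(u)-\Phi(v)}{d(u,v)},0\right\}$, and $|\partial\Phi|(u):=+\infty$ for $u\notin\operatorname{dom}\Phi$. It is known that, when $\Phi$ is lower semicontinuous, $|\partial\Phi|$ is a strong upper gradient of $\Phi$ in the sense below (completeness of $X$ is not needed), so $\mathcal M(|\partial\Phi|)$ is meaningful. Locally absolutely continuous curve: a curve $v:(0,+\infty)\to X$ for which there is a nonnegative $m\in L^1_{\mathrm{loc}}(0,+\infty)$ with $d(v(t),v(s))\le\int_s^t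 m(r)\,dr$ for all $0<s\le t$. For such a curve the metric derivative $|\dot v|(t):=\lim_{h\to0}\frac{d(v(t+h),v(t))}{|h|}$ exists for a.e. $t$ and belongs to $L^1_{\mathrm{loc}}(0,+\infty)$. (Strong) upper gradient of $\Phi$: a nonnegative function $g:X\to\mathbb R\cup\{+\infty\}$ such that for every locally absolutely continuous curve $v:(0,+\infty)\to X$ with values in $\operatorname{dom}\Phi$, the function $g\circ v$ is Borel measurable and $|\Phi(v(t))-\Phi(v(s))|\le\int_s^t g(v(r))\,|\dot v|(r)\,dr$ for all $0<s\le t$ (the right-hand side may be $+\infty$). Gradient flow of $\Phi$ with respect to an upper gradient $g$: a locally absolutely continuous curve $v:(0,+\infty)\to X$ such that (1) $v(t)\in\operatorname{dom}\Phi$ for all $t>0$; (2) $\Phi(v(t))-\Phi(v(s))\le-\frac12\int_s^t|\dot v|(r)^2\,dr-\frac12\int_s^t g(v(r))^2\,dr$ for all $s,t\in(0,+\infty)$ (integrals are oriented). $\mathcal M(g)$ is the set of all $u\in\operatorname{dom}\Phi$ for which there exists a gradient flow $v:(0,+\infty)\to X$ of $\Phi$ with respect to $g$ with $\lim_{t\to0^+}v(t)=u$ and $\lim_{t\to0^+}\Phi(v(t))=\Phi(u)$. *)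

theory Defs
  imports "HOL-Analysis.Analysis"
begin

text \<open>Functionals with values in the reals extended by plus infinity are modelled as functions
  into \<^typ>\<open>ereal\<close>; that minus infinity is not attained is a separate assumption.\<close>

definition dom_fun :: "('a \<Rightarrow> ereal) \<Rightarrow> 'a set" where
  "dom_fun \<Phi> = {u. \<Phi> u < \<infinity>}"

definition proper :: "('a \<Rightarrow> ereal) \<Rightarrow> bool" where
  "proper \<Phi> \<longleftrightarrow> dom_fun \<Phi> \<noteq> {}"

definition lower_semicontinuous :: "('a::topological_space \<Rightarrow> ereal) \<Rightarrow> bool" where
  "lower_semicontinuous \<Phi> \<longleftrightarrow> (\<forall>x. \<forall>c < \<Phi> x. \<forall>\<^sub>F y in nhds x. c < \<Phi> y)"

text \<open>If the space is the single point \<open>u\<close>, the supremum below is over the empty set, hence minus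
  infinity, and the slope is \<open>0\<close>. Points \<open>v\<close> outside the domain contribute minus infinity.\<close>

definition global_slope :: "('a::metric_space \<Rightarrow> ereal) \<Rightarrow> 'a \<Rightarrow> ereal" where
  "global_slope \<Phi> u =
     (if u \<in> dom_fun \<Phi>
      then max (SUP v\<in>UNIV - {u}. (\<Phi> u - \<Phi> v) / ereal (dist u v)) 0
      else \<infinity>)"

text \<open>A curve on the open half-line is a function on \<^typ>\<open>real\<close> whose values at nonpositive times
  are irrelevant: no definition below depends on them.\<close>

definition locally_abs_continuous :: "(real \<Rightarrow> 'a::metric_space) \<Rightarrow> bool" where
  "locally_abs_continuous v \<longleftrightarrow>
     (\<exists>m :: real \<Rightarrow> real.
        (\<forall>r>0. 0 \<le> m r) \<and>
        (\<forall>a b. 0 < a \<and> a \<le> b \<longrightarrow> set_integrable lebesgue {a..b} m) \<and>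
        (\<forall>s t. 0 < s \<and> s \<le> t \<longrightarrow> dist (v t) (v s) \<le> (LINT r:{s..t}|lebesgue. m r)))"

text \<open>At the times where the limit does not exist (a null set for locally absolutely continuous
  curves) the value is unspecified.\<close>

definition metric_derivative :: "(real \<Rightarrow> 'a::metric_space) \<Rightarrow> real \<Rightarrow> real" where
  "metric_derivative v t = Lim (at 0) (\<lambda>h. dist (v (t + h)) (v t) / \<bar>h\<bar>)"

text \<open>Integrals of nonnegative functions may be infinite and are taken in \<^typ>\<open>ennreal\<close>, with the
  convention that \<open>0\<close> times infinity is \<open>0\<close> in integrands.\<close>

definition strong_upper_gradient ::
  "('a::metric_space \<Rightarrow> ereal) \<Rightarrow> ('a \<Rightarrow> ereal) \<Rightarrow> bool" where
  "strong_upper_gradient \<Phi> g \<longleftrightarrow>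
     (\<forall>x. 0 \<le> g x) \<and>
     (\<forall>v. locally_abs_continuous v \<and> (\<forall>t>0. v t \<in> dom_fun \<Phi>) \<longrightarrow>
        (\<lambda>r. g (v r)) \<in> borel_measurable (restrict_space borel {0<..}) \<and>
        (\<forall>s t. 0 < s \<and> s \<le> t \<longrightarrow>
           \<bar>\<Phi> (v t) - \<Phi> (v s)\<bar> \<le>
             enn2ereal (\<integral>\<^sup>+r\<in>{s..t}. (e2ennreal (g (v r)) * ennreal (metric_derivative v r)) \<partial>lebesgue)))"

definition oriented_nn_integral :: "(real \<Rightarrow> ennreal) \<Rightarrow> real \<Rightarrow> real \<Rightarrow> ereal" where
  "oriented_nn_integral f s t =
     (if s \<le> t then enn2ereal (\<integral>\<^sup>+r\<in>{s..t}. f r \<partial>lebesgue)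
      else - enn2ereal (\<integral>\<^sup>+r\<in>{t..s}. f r \<partial>lebesgue))"

text \<open>In the following two definitions \<open>g\<close> is meant to be a strong upper gradient of \<open>\<Phi>\<close>. This is
  not repeated as a clause: the global slope of a lower semicontinuous functional always is one.
  The two oriented integrals in the energy inequality have the same sign, so their sum is never of
  the form infinity minus infinity.\<close>

definition gradient_flow ::
  "('a::metric_space \<Rightarrow> ereal) \<Rightarrow> ('a \<Rightarrow> ereal) \<Rightarrow> (real \<Rightarrow> 'a) \<Rightarrow> bool" where
  "gradient_flow \<Phi> g v \<longleftrightarrow>
     locally_abs_continuous v \<and>
     (\<forall>t>0. v t \<in> dom_fun \<Phi>) \<and>
     (\<forall>s>0. \<forall>t>0.
        \<Phi> (v t) - \<Phi> (v s) \<le>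
          - (ereal (1/2) * oriented_nn_integral (\<lambda>r. (ennreal (metric_derivative v r))\<^sup>2) s t)
          - (ereal (1/2) * oriented_nn_integral (\<lambda>r. (e2ennreal (g (v r)))\<^sup>2) s t))"

definition flow_starting_points ::
  "('a::metric_space \<Rightarrow> ereal) \<Rightarrow> ('a \<Rightarrow> ereal) \<Rightarrow> 'a set" where
  "flow_starting_points \<Phi> g =
     {u \<in> dom_fun \<Phi>. \<exists>v. gradient_flow \<Phi> g v \<and>
        (v \<longlongrightarrow> u) (at_right 0) \<and> ((\<lambda>t. \<Phi> (v t)) \<longlongrightarrow> \<Phi> u) (at_right 0)}"

end

theory Submission
  imports Defs
begin

text \<open>
  Let \<open>c = \<epsilon> / l\<close> and let \<open>C\<close> be the set of all \<open>x\<close> with \<open>\<Phi> x \<le> \<Phi> z + c d(z, x)\<close> for all \<open>z\<close>, which is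
  closed by lower semicontinuity. Outside \<open>C\<close> the global slope is at least \<open>c\<close>, so along a flow \<open>v\<close>
  from \<open>u\<close> the energy falls at least at rate \<open>c\<^sup>2 / 2\<close> before \<open>v\<close> enters \<open>C\<close>; as \<open>\<Phi>\<close> is bounded below,
  there is a first time \<open>T\<close> with \<open>v T \<in> C\<close>. Up to \<open>T\<close>, the energy inequality and \<open>2 c p \<le> p\<^sup>2 + c\<^sup>2\<close> give
  \<open>\<Phi> (v s) - \<Phi> (v T) \<ge> c \<integral> |v'| \<ge> c d(v s, v T)\<close>, whence (b), and (a) follows from (b). The flow
  restarted at \<open>v T\<close> keeps \<open>\<Phi>\<close> continuous at the initial time, since \<open>\<Phi>\<close> is nonincreasing along it
  and lower semicontinuous.

  The second inequality needs that the metric derivative exists almost everywhere and integrates to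
  at least the distance. Lebesgue's differentiation theorem on the line follows from Henstock's lemma
  and Vitali's covering theorem. It yields that the distance is at most the integral of each one-sided
  lower speed; applied to these integrals, it shows that both lower speeds agree with the full limit.
\<close>

subsection \<open>Differentiation of indefinite integrals\<close>

lemma integral_atLeastAtMost_diff:
  fixes f :: "real \<Rightarrow> real"
  assumes f: "f integrable_on {a..b}" and "a \<le> s" "s \<le> t" "t \<le> b"
  shows "integral {s..t} f = integral {a..t} f - integral {a..s} f"
proof -
  have "f integrable_on {a..t}"
    using assms by (meson atLeastatMost_subset_iff integrable_on_subinterval order_refl)
  then show ?thesis
    using Henstock_Kurzweil_Integration.integral_combine [of a s t f] assms by simp
qed

lemma mono_indefinite_integral:
  fixes f :: "real \<Rightarrow> real"
  assumes f: "f integrable_on {a..b}" and nn: "\<And>x. x \<in> {a..b} \<Longrightarrow> 0 \<le> f x" and "a \<le> x" "x \<le> y" "y \<le> b"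
  shows "integral {a..x} f \<le> integral {a..y} f"
proof -
  have "f integrable_on {x..y}" using assms by (meson atLeastatMost_subset_iff integrable_on_subinterval)
  then have "0 \<le> integral {x..y} f" using assms by (intro Henstock_Kurzweil_Integration.integral_nonneg) auto
  then show ?thesis using integral_atLeastAtMost_diff[OF f, of x y] assms by simp
qed

text \<open>Each exceptional point is an endpoint of arbitrarily short intervals on which
  \<open>F\<close> deviates from its linear approximation by more than \<open>e\<close> times the
  length. Vitali's theorem selects countably many disjoint ones covering almost all such points, and
  Henstock's lemma bounds the total deviation, hence the total length.\<close>

lemma negligible_indefinite_integral_deviation:
  fixes f :: "real \<Rightarrow> real"
  assumes f: "f integrable_on {a..b}" and "e > 0"
  defines "F \<equiv> \<lambda>x. integral {a..x} f"
  shows "negligible {x \<in> {a<..<b}. \<forall>d>0. \<exists>y\<in>{a..b}. y \<noteq> x \<and> \<bar>y - x\<bar> < d \<and>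
           e * \<bar>y - x\<bar> < \<bar>F y - F x - f x * (y - x)\<bar>}" (is "negligible ?E")
  unfolding negligible_outer_le
proof (intro allI impI)
  fix k :: real assume "k > 0"
  with \<open>e > 0\<close> have "e * k > 0" by simp
  from f have f': "f integrable_on cbox a b" by simp
  \<comment> \<open>The tolerance \<open>e * k\<close> becomes a bound \<open>k\<close> on the total
    length once the factor \<open>e\<close> is cancelled.\<close>
  obtain \<gamma> where \<gamma>: "gauge \<gamma>"
    and hen: "\<And>p. \<lbrakk>p tagged_partial_division_of (cbox a b); \<gamma> fine p\<rbrakk> \<Longrightarrow>
             sum (\<lambda>(x,k). norm (measure lborel k *\<^sub>R f x - integral k f)) p < e * k"
    using Henstock_lemma [OF f' \<open>e * k > 0\<close>] by blast
  define J where "J = (\<lambda>(x::real,y::real). {min x y..max x y})"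
  \<comment> \<open>A pair consists of the tag \<open>x\<close> and the other endpoint
    \<open>y\<close>, on either side of \<open>x\<close>. The centres \<open>c\<close> and radii
    \<open>r\<close> below only present the intervals as balls for the covering theorem.\<close>
  define K where "K = {(x,y). x \<in> ?E \<and> y \<in> {a..b} \<and> y \<noteq> x \<and> J (x,y) \<subseteq> \<gamma> x \<and>
           e * \<bar>y - x\<bar> < \<bar>F y - F x - f x * (y - x)\<bar>}"
  have KD: "a < x \<and> x < b \<and> a \<le> y \<and> y \<le> b \<and> J (x,y) \<subseteq> \<gamma> x \<and>
       e * \<bar>y - x\<bar> < \<bar>F y - F x - f x * (y - x)\<bar>" if "(x,y) \<in> K" for x y
    using that by (auto simp: K_def)
  define c where "c = (\<lambda>(x::real,y::real). (x + y) / 2)"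
  define r where "r = (\<lambda>(x::real,y::real). \<bar>y - x\<bar> / 2)"
  have cball_J: "cball (c i) (r i) = J i" for i
  proof -
    obtain x y where i: "i = (x, y)" by force
    have "(x + y) / 2 - \<bar>y - x\<bar> / 2 = min x y" "(x + y) / 2 + \<bar>y - x\<bar> / 2 = max x y"
      by (auto simp: min_def max_def field_simps)
    then show ?thesis by (simp only: i c_def r_def J_def prod.case cball_eq_atLeastAtMost)
  qed
  have rpos: "0 < r i" if "i \<in> K" for i
    using that by (auto simp: K_def r_def)
  have fine: "\<exists>i. i \<in> K \<and> x \<in> cball (c i) (r i) \<and> r i < d" if x: "x \<in> ?E" and "0 < d" for x d
  proof -
    from \<gamma> have "x \<in> \<gamma> x" "open (\<gamma> x)" by (auto simp: gauge_def)
    then obtain d' where "d' > 0" and d': "ball x d' \<subseteq> \<gamma> x" by (meson open_contains_ball)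
    from \<open>0 < d\<close> \<open>0 < d'\<close> have "min d d' > 0" by simp
    with x obtain y where y: "y \<in> {a..b}" "y \<noteq> x" "\<bar>y - x\<bar> < min d d'"
      "e * \<bar>y - x\<bar> < \<bar>F y - F x - f x * (y - x)\<bar>" by blast
    have "J (x,y) \<subseteq> ball x d'" using y by (auto simp: J_def dist_real_def min_def max_def split: if_splits)
    then have "(x,y) \<in> K" using x y d' by (auto simp: K_def)
    moreover have "x \<in> cball (c (x,y)) (r (x,y))" unfolding cball_J J_def by auto
    moreover have "r (x,y) < d" using y by (auto simp: r_def)
    ultimately show ?thesis by blast
  qed
  obtain C where C: "countable C" "C \<subseteq> K"
     "pairwise (\<lambda>i j. disjnt (cball (c i) (r i)) (cball (c j) (r j))) C"
     "negligible(?E - (\<Union>i \<in> C. cball (c i) (r i)))"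
    by (rule Vitali_covering_theorem_cballs [OF rpos fine])
  have disj: "J i \<inter> J j = {}" if "i \<in> C" "j \<in> C" "i \<noteq> j" for i j
    using C(3) that by (auto simp: pairwise_def disjnt_def cball_J)
  \<comment> \<open>Henstock's lemma speaks of finite partial divisions only. A bound uniform in the
    finite subfamily carries over to the countable union.\<close>
  have bound: "measure lebesgue (\<Union>i\<in>C'. J i) \<le> k" if C': "C' \<subseteq> C" "finite C'" for C'
  proof -
    have C'K: "C' \<subseteq> K" using C' C by auto
    define p where "p = (\<lambda>i. (fst i, J i)) ` C'"
    have J_ne: "fst i \<in> J i" for i by (cases i) (auto simp: J_def)
    have inj: "inj_on (\<lambda>i. (fst i, J i)) C'"
    proof (rule inj_onI, rule ccontr)
      fix i j assume ij: "i \<in> C'" "j \<in> C'" "(fst i, J i) = (fst j, J j)" "i \<noteq> j"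
      with disj C' have "J i \<inter> J j = {}" by blast
      with ij J_ne[of i] show False by auto
    qed
    have part: "p tagged_partial_division_of cbox a b"
      unfolding tagged_partial_division_of_def
    proof (intro conjI allI impI)
      show "finite p" using C' by (simp add: p_def)
      fix x S assume "(x, S) \<in> p"
      then obtain i where i: "i \<in> C'" "x = fst i" "S = J i" by (auto simp: p_def)
      show "x \<in> S" using i J_ne by simp
      show "S \<subseteq> cbox a b"
      proof -
        obtain u w where uw: "i = (u, w)" by force
        then have "a < u \<and> u < b \<and> a \<le> w \<and> w \<le> b" using i C'K KD[of u w] by blast
        then show ?thesis using i uw by (auto simp: J_def)
      qed
      show "\<exists>a b. S = cbox a b" using i by (cases i) (auto simp: J_def)
    next
      fix x S y T assume "(x, S) \<in> p \<and> (y, T) \<in> p \<and> (x, S) \<noteq> (y, T)"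
      then obtain i j where "i \<in> C'" "j \<in> C'" "S = J i" "T = J j" "i \<noteq> j" by (auto simp: p_def)
      then have "S \<inter> T = {}" using disj C' by blast
      then show "interior S \<inter> interior T = {}"
        using interior_subset by blast
    qed
    have "\<gamma> fine p"
      unfolding fine_def p_def using C'K KD by fastforce
    from hen [OF part this]
    have "(\<Sum>i\<in>C'. norm (measure lborel (J i) *\<^sub>R f (fst i) - integral (J i) f)) < e * k"
      unfolding p_def by (simp add: sum.reindex [OF inj])
    moreover have "e * measure lebesgue (J i) \<le> norm (measure lborel (J i) *\<^sub>R f (fst i) - integral (J i) f)"
      if "i \<in> C'" for i
    proof -
      obtain x y where i: "i = (x,y)" by force
      with that C'K have xy: "a < x" "x < b" "a \<le> y" "y \<le> b"
        "e * \<bar>y - x\<bar> < \<bar>F y - F x - f x * (y - x)\<bar>" using KD[of x y] by auto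
      have comb: "integral {u..v} f = F v - F u" if "a \<le> u" "u \<le> v" "v \<le> b" for u v
        unfolding F_def by (rule integral_atLeastAtMost_diff[OF f that])
      show ?thesis
      proof (cases "x \<le> y")
        case True
        then show ?thesis using xy comb [of x y] by (simp add: i J_def abs_minus_commute algebra_simps)
      next
        case False
        then have "integral {y..x} f = F x - F y" using xy comb [of y x] by simp
        moreover have "(x - y) * f x - (F x - F y) = F y - F x - f x * (y - x)" by (simp add: algebra_simps)
        ultimately show ?thesis using xy False by (simp add: i J_def)
      qed
    qed
    then have "e * (\<Sum>i\<in>C'. measure lebesgue (J i)) \<le> (\<Sum>i\<in>C'. norm (measure lborel (J i) *\<^sub>R f (fst i) - integral (J i) f))"
      unfolding sum_distrib_left by (rule sum_mono)
    ultimately have "e * (\<Sum>i\<in>C'. measure lebesgue (J i)) \<le> e * k" by linarith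
    then have "(\<Sum>i\<in>C'. measure lebesgue (J i)) \<le> k" using \<open>e > 0\<close> by simp
    moreover have "measure lebesgue (\<Union>i\<in>C'. J i) \<le> (\<Sum>i\<in>C'. measure lebesgue (J i))"
      using C' by (intro measure_UNION_le) (auto simp: J_def split: prod.splits)
    ultimately show ?thesis by linarith
  qed
  have J_meas: "J i \<in> lmeasurable" for i by (cases i) (auto simp: J_def)
  let ?U = "\<Union>i\<in>C. J i"
  have U: "?U \<in> lmeasurable" "measure lebesgue ?U \<le> k"
    using fmeasurable_UN_bound [OF C(1) J_meas bound] measure_UN_bound [OF C(1) J_meas bound] by blast+
  let ?N = "?E - ?U"
  have N: "negligible ?N" using C(4) by (simp add: cball_J)
  show "\<exists>T. ?E \<subseteq> T \<and> T \<in> lmeasurable \<and> measure lebesgue T \<le> k"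
  proof (intro exI conjI)
    show "?E \<subseteq> ?N \<union> ?U" by blast
    show "?N \<union> ?U \<in> lmeasurable" using U N negligible_imp_measurable by blast
    show "measure lebesgue (?N \<union> ?U) \<le> k"
      using measure_Un_le[of ?N lebesgue ?U] U N negligible_imp_measurable[OF N] negligible_imp_measure0[OF N]
      by (simp add: fmeasurableD)
  qed
qed

text \<open>Failure of differentiability with derivative \<open>f x\<close> means a deviation of
  some fixed relative size at arbitrarily small scales. Sizes \<open>inverse (real (Suc n))\<close>
  suffice, which leaves a countable union of null sets.\<close>

theorem negligible_not_has_derivative_indefinite_integral:
  fixes f :: "real \<Rightarrow> real"
  assumes f: "f integrable_on {a..b}"
  shows "negligible {x \<in> {a<..<b}. \<not> ((\<lambda>x. integral {a..x} f) has_real_derivative f x) (at x)}"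
proof -
  define F where "F = (\<lambda>x. integral {a..x} f)"
  define E where "E = (\<lambda>e. {x \<in> {a<..<b}. \<forall>d>0. \<exists>y\<in>{a..b}. y \<noteq> x \<and> \<bar>y - x\<bar> < d \<and>
           e * \<bar>y - x\<bar> < \<bar>F y - F x - f x * (y - x)\<bar>})"
  have "negligible (\<Union>n. E (inverse (real (Suc n))))"
    unfolding E_def F_def by (intro negligible_countable_Union) (use negligible_indefinite_integral_deviation[OF f] in auto)
  moreover have "{x \<in> {a<..<b}. \<not> (F has_real_derivative f x) (at x)} \<subseteq> (\<Union>n. E (inverse (real (Suc n))))"
  proof (rule ccontr)
    assume "\<not> ?thesis"
    then obtain x where x: "x \<in> {a<..<b}" "\<not> (F has_real_derivative f x) (at x)"
      and nE: "\<And>n. x \<notin> E (inverse (real (Suc n)))" by blast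
    have "((\<lambda>y. (F y - F x) / (y - x)) \<longlongrightarrow> f x) (at x)"
      unfolding LIM_eq
    proof (intro allI impI)
      fix r :: real assume "r > 0"
      then obtain n where n: "inverse (real (Suc n)) < r" using reals_Archimedean by blast
      from nE[of n] x obtain d where "d > 0" and d': "\<not> (\<exists>y\<in>{a..b}. y \<noteq> x \<and> \<bar>y - x\<bar> < d \<and>
           inverse (real (Suc n)) * \<bar>y - x\<bar> < \<bar>F y - F x - f x * (y - x)\<bar>)"
        unfolding E_def by blast
      then have d: "\<bar>F y - F x - f x * (y - x)\<bar> \<le> inverse (real (Suc n)) * \<bar>y - x\<bar>"
        if "y \<in> {a..b}" "y \<noteq> x" "\<bar>y - x\<bar> < d" for y
        using that by (auto simp: not_less)
      show "\<exists>s>0. \<forall>y. y \<noteq> x \<and> norm (y - x) < s \<longrightarrow> norm ((F y - F x) / (y - x) - f x) < r"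
      \<comment> \<open>The deviation estimate holds only for \<open>y\<close> in
        \<open>{a..b}\<close>, so the radius must also stay below the distances from
        \<open>x\<close> to the endpoints.\<close>
      proof (intro exI[of _ "min d (min (x - a) (b - x))"] conjI allI impI)
        show "0 < min d (min (x - a) (b - x))" using x \<open>d > 0\<close> by auto
        fix y assume y: "y \<noteq> x \<and> norm (y - x) < min d (min (x - a) (b - x))"
        then have "\<bar>F y - F x - f x * (y - x)\<bar> \<le> inverse (real (Suc n)) * \<bar>y - x\<bar>"
          by (intro d) auto
        also have "\<dots> < r * \<bar>y - x\<bar>" using n y by (intro mult_strict_right_mono) auto
        finally have "\<bar>F y - F x - f x * (y - x)\<bar> / \<bar>y - x\<bar> < r" using y by (simp add: divide_simps)
        moreover have "(F y - F x) / (y - x) - f x = (F y - F x - f x * (y - x)) / (y - x)"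
          using y by (simp add: field_simps)
        ultimately show "norm ((F y - F x) / (y - x) - f x) < r" by simp
      qed
    qed
    then show False using x by (simp add: has_field_derivative_iff)
  qed
  ultimately show ?thesis unfolding F_def by (rule negligible_subset)
qed

subsection \<open>One-sided lower speeds and the metric derivative\<close>

text \<open>A continuation argument: the points \<open>x\<close> with the inequality on
  \<open>{s..x}\<close> form a compact set. If its largest element were below \<open>t\<close>, one
  more step and the triangle inequality would give a larger one.\<close>

lemma dist_le_of_local_increments:
  fixes w :: "real \<Rightarrow> 'a::metric_space" and G :: "real \<Rightarrow> real"
  assumes "s \<le> t" and w: "continuous_on {s..t} w" and G: "continuous_on {s..t} G"
    and step: "\<And>x. \<lbrakk>s \<le> x; x < t\<rbrakk> \<Longrightarrow> \<exists>h>0. x + h \<le> t \<and> dist (w x) (w (x + h)) \<le> G (x + h) - G x"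
  shows "dist (w s) (w t) \<le> G t - G s"
proof -
  let ?f = "\<lambda>x. dist (w s) (w x) - (G x - G s)"
  define S where "S = {s..t} \<inter> ?f -` {..0}"
  have "continuous_on {s..t} ?f"
    by (intro continuous_on_diff continuous_on_dist continuous_on_const w G)
  then have "closed S" unfolding S_def by (rule continuous_closed_preimage) simp_all
  then have "compact S"
    using compact_eq_bounded_closed bounded_subset[of "{s..t}" S] by (auto simp: S_def)
  moreover have "s \<in> S" using \<open>s \<le> t\<close> by (simp add: S_def)
  ultimately obtain x where x: "x \<in> S" and mx: "\<And>y. y \<in> S \<Longrightarrow> y \<le> x"
    by (metis compact_attains_sup empty_iff)
  have "x = t"
  proof (rule ccontr)
    assume "x \<noteq> t"
    with x have "s \<le> x" "x < t" by (auto simp: S_def)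
    from step[OF this] obtain h where h: "h > 0" "x + h \<le> t" "dist (w x) (w (x + h)) \<le> G (x + h) - G x"
      by blast
    have "dist (w s) (w (x + h)) \<le> dist (w s) (w x) + dist (w x) (w (x + h))" by (rule dist_triangle)
    with h x have "x + h \<in> S" by (auto simp: S_def)
    with mx h show False by fastforce
  qed
  with x show ?thesis by (simp add: S_def)
qed

text \<open>Time reversal of the previous lemma; \<open>G\<close> turns into
  \<open>- G (- x)\<close> so that it still increases in the new time.\<close>

lemma dist_le_of_local_increments_left:
  fixes w :: "real \<Rightarrow> 'a::metric_space" and G :: "real \<Rightarrow> real"
  assumes "s \<le> t" and w: "continuous_on {s..t} w" and G: "continuous_on {s..t} G"
    and step: "\<And>x. \<lbrakk>s < x; x \<le> t\<rbrakk> \<Longrightarrow> \<exists>h>0. s \<le> x - h \<and> dist (w (x - h)) (w x) \<le> G x - G (x - h)"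
  shows "dist (w s) (w t) \<le> G t - G s"
proof -
  have "dist (w (- (-t))) (w (- (-s))) \<le> - G (- (- s)) - (- G (- (- t)))"
  proof (rule dist_le_of_local_increments[where w = "\<lambda>x. w (- x)" and G = "\<lambda>x. - G (- x)"])
    show "continuous_on {-t..-s} (\<lambda>x. w (- x))" "continuous_on {-t..-s} (\<lambda>x. - G (- x))"
      by (auto intro!: continuous_intros continuous_on_compose2[OF w] continuous_on_compose2[OF G])
    fix x assume "- t \<le> x" "x < - s"
    with step[of "- x"] obtain h where "h > 0" "s \<le> - x - h" "dist (w (- x - h)) (w (- x)) \<le> G (- x) - G (- x - h)"
      by auto
    then show "\<exists>h>0. x + h \<le> - s \<and> dist (w (- x)) (w (- (x + h))) \<le> - G (- (x + h)) - - G (- x)"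
      by (intro exI[of _ h]) (auto simp: dist_commute)
  qed (use \<open>s \<le> t\<close> in auto)
  then show ?thesis by (simp add: dist_commute)
qed

text \<open>Dominated convergence along decreasing open neighbourhoods of \<open>N\<close>. The set
  \<open>U\<close> will later absorb the points at which no derivative is available.\<close>

lemma negligible_open_superset_small_integral:
  fixes m :: "real \<Rightarrow> real"
  assumes m: "m absolutely_integrable_on {a..b}" and N: "negligible N" and "e > 0"
  obtains U where "open U" "N \<subseteq> U" "integral {a..b} (\<lambda>x. if x \<in> U then \<bar>m x\<bar> else 0) < e"
    "(\<lambda>x. if x \<in> U then \<bar>m x\<bar> else 0) integrable_on {a..b}"
proof -
  have "\<exists>T. open T \<and> N \<subseteq> T \<and> measure lebesgue T < inverse (2^n) \<and> T \<in> lmeasurable" for n :: nat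
  proof -
    have NL: "N \<in> lmeasurable" "measure lebesgue N = 0"
      using N by (simp_all add: negligible_imp_measurable negligible_imp_measure0)
    obtain T where T: "open T" "N \<subseteq> T" "T - N \<in> lmeasurable" "emeasure lebesgue (T - N) < ennreal (inverse (2^n))"
      using sets_lebesgue_outer_open[OF fmeasurableD[OF NL(1)], of "inverse (2^n)"] by auto
    have eq: "T = (T - N) \<union> N" using T by blast
    have "T \<in> lmeasurable" using T NL by (subst eq) blast
    moreover have "measure lebesgue T \<le> measure lebesgue (T - N) + measure lebesgue N"
      by (subst eq, rule measure_Un_le) (use T NL in auto)
    moreover have "measure lebesgue (T - N) < inverse (2^n)"
      using T by (simp add: emeasure_eq_measure2 ennreal_less_iff)
    ultimately show ?thesis using T NL by auto
  qed
  then obtain T where T: "\<And>n. open (T n)" "\<And>n. N \<subseteq> T n" "\<And>n. measure lebesgue (T n) < inverse (2^n)"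
    "\<And>n. T n \<in> lmeasurable" by metis
  define U where "U = (\<lambda>n. \<Inter>k\<le>n. T k)"
  have U: "open (U n)" "N \<subseteq> U n" for n unfolding U_def using T by auto
  have Ulebesgue: "U n \<in> sets lebesgue" for n
    by (rule sets_completionI_sets) (use U in simp)
  \<comment> \<open>\<open>N'\<close> may exceed \<open>N\<close>, but it is still null, and it is
    the limit of the decreasing sets \<open>U n\<close>.\<close>
  define N' where "N' = (\<Inter>n. T n)"
  have "negligible N'"
    unfolding negligible_outer
  proof (intro allI impI)
    fix e :: real assume "e > 0"
    then obtain n where "(1/2)^n < e" using real_arch_pow_inv[of e "1/2"] by auto
    then show "\<exists>S. N' \<subseteq> S \<and> S \<in> lmeasurable \<and> measure lebesgue S < e"
      using T[of n] by (intro exI[of _ "T n"]) (auto simp: N'_def power_one_over inverse_eq_divide intro: order_less_trans)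
  qed
  let ?m = "\<lambda>x. \<bar>m x\<bar>"
  define f where "f = (\<lambda>n x. if x \<in> U n then ?m x else 0)"
  have mm: "?m absolutely_integrable_on {a..b}" using absolutely_integrable_abs[OF m] by simp
  have f_int: "f n integrable_on {a..b}" for n
  proof -
    have "?m absolutely_integrable_on (U n \<inter> {a..b})"
      by (rule set_integrable_subset[OF mm]) (use Ulebesgue in auto)
    then have "?m integrable_on (U n \<inter> {a..b})" using absolutely_integrable_on_def by blast
    then show ?thesis by (simp add: f_def integrable_restrict_Int)
  qed
  have "(\<lambda>n. integral {a..b} (f n)) \<longlonglongrightarrow> integral {a..b} (\<lambda>x. if x \<in> N' then ?m x else 0)"
  proof (rule dominated_convergence(2)[OF f_int])
    show "?m integrable_on {a..b}" using mm absolutely_integrable_on_def by blast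
    show "norm (f n x) \<le> ?m x" for n x by (simp add: f_def)
    show "(\<lambda>n. f n x) \<longlonglongrightarrow> (if x \<in> N' then ?m x else 0)" for x
    proof (cases "x \<in> N'")
      case True then show ?thesis by (simp add: f_def N'_def U_def)
    next
      case False
      then obtain k where "x \<notin> T k" by (auto simp: N'_def)
      then have "eventually (\<lambda>n. f n x = 0) sequentially"
        unfolding eventually_sequentially by (intro exI[of _ k]) (auto simp: f_def U_def)
      with False show ?thesis by (simp add: tendsto_eventually)
    qed
  qed
  also have "integral {a..b} (\<lambda>x. if x \<in> N' then ?m x else 0) = integral {a..b} (\<lambda>x. 0)"
    by (rule integral_spike[OF \<open>negligible N'\<close>]) auto
  finally have "(\<lambda>n. integral {a..b} (f n)) \<longlonglongrightarrow> 0" by simp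
  with \<open>e > 0\<close> have "eventually (\<lambda>n. integral {a..b} (f n) < e) sequentially"
    by (metis order_tendstoD(2))
  then obtain n where n: "integral {a..b} (f n) < e" by (auto simp: eventually_sequentially)
  show thesis
  proof (rule that[OF U])
    show "integral {a..b} (\<lambda>x. if x \<in> U n then ?m x else 0) < e" using n by (simp add: f_def)
    show "(\<lambda>x. if x \<in> U n then ?m x else 0) integrable_on {a..b}" using f_int[of n] by (simp add: f_def)
  qed
qed

text \<open>The lower limit of \<open>d(w(x), w(x + \<sigma> h)) / h\<close> as \<open>h\<close> decreases to \<open>0\<close>, used for \<open>\<sigma> = 1\<close> and \<open>\<sigma> = -1\<close>.
  For continuous \<open>w\<close>, rational increments suffice, and they make measurability immediate.\<close>

definition lower_speed :: "real \<Rightarrow> (real \<Rightarrow> 'a::metric_space) \<Rightarrow> real \<Rightarrow> ereal" where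
  "lower_speed \<sigma> w x =
     (SUP n. INF q\<in>{q \<in> \<rat>. 0 < q \<and> q < inverse (real (Suc n))}.
        ereal (dist (w x) (w (x + \<sigma> * q)) / q))"

lemma borel_measurable_lower_speed [measurable]:
  assumes w: "continuous_on UNIV w"
  shows "lower_speed \<sigma> w \<in> borel_measurable borel"
proof -
  have "(\<lambda>x. ereal (dist (w x) (w (x + \<sigma> * q)) / q)) \<in> borel_measurable borel" for q
    unfolding divide_inverse
    by (intro borel_measurable_continuous_onI borel_measurable_ereal)
       (auto intro!: continuous_intros continuous_on_compose2[OF w] w)
  moreover have "countable {q \<in> \<rat>. 0 < q \<and> q < inverse (real (Suc n))}" for n
    by (rule countable_subset[OF _ countable_rat]) auto
  ultimately show ?thesis unfolding lower_speed_def[abs_def]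
    by (intro borel_measurable_SUP borel_measurable_INF) auto
qed

lemma lower_speed_nonneg: "0 \<le> lower_speed \<sigma> w x"
  unfolding lower_speed_def by (rule SUP_upper2[of 0]) (auto intro!: INF_greatest)

lemma lower_speed_less_obtains:
  assumes "lower_speed \<sigma> w x < ereal c" "d > 0"
  obtains h where "0 < h" "h < d" "dist (w x) (w (x + \<sigma> * h)) \<le> c * h"
proof -
  obtain n where n: "inverse (real (Suc n)) < d" using reals_Archimedean[OF \<open>d > 0\<close>] by blast
  have "(INF q\<in>{q \<in> \<rat>. 0 < q \<and> q < inverse (real (Suc n))}.
        ereal (dist (w x) (w (x + \<sigma> * q)) / q)) < ereal c"
    by (rule le_less_trans[OF _ assms(1)]) (unfold lower_speed_def, rule SUP_upper, simp)
  then obtain q where "0 < q" "q < inverse (real (Suc n))" "dist (w x) (w (x + \<sigma> * q)) / q < c"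
    unfolding INF_less_iff by auto
  moreover from this n have "q < d" by linarith
  ultimately show thesis by (intro that[of q]) (auto simp: divide_simps)
qed

lemma lower_speed_leI:
  assumes "d > 0" and le: "\<And>h. \<lbrakk>0 < h; h < d\<rbrakk> \<Longrightarrow> dist (w x) (w (x + \<sigma> * h)) \<le> c * h"
  shows "lower_speed \<sigma> w x \<le> ereal c"
  unfolding lower_speed_def
proof (rule SUP_least)
  fix n :: nat
  have "0 < min d (inverse (real (Suc n)))" using \<open>d > 0\<close> by simp
  from Rats_dense_in_real[OF this] obtain q where q: "q \<in> \<rat>" "0 < q" "q < min d (inverse (real (Suc n)))"
    by blast
  with le[of q] show "(INF q\<in>{q \<in> \<rat>. 0 < q \<and> q < inverse (real (Suc n))}.
        ereal (dist (w x) (w (x + \<sigma> * q)) / q)) \<le> ereal c"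
    by (intro INF_lower2[of q]) (auto simp: divide_simps)
qed

text \<open>The definition controls rational increments only. By continuity the increments that
  violate the bound form an open set, which would contain a rational one.\<close>

lemma lower_speed_greater_obtains:
  assumes w: "continuous_on UNIV w" and less: "ereal c < lower_speed \<sigma> w x"
  obtains d where "d > 0" "\<And>h. \<lbrakk>0 < h; h < d\<rbrakk> \<Longrightarrow> c * h \<le> dist (w x) (w (x + \<sigma> * h))"
proof -
  from less obtain n where n: "ereal c < (INF q\<in>{q \<in> \<rat>. 0 < q \<and> q < inverse (real (Suc n))}.
        ereal (dist (w x) (w (x + \<sigma> * q)) / q))"
    unfolding lower_speed_def less_SUP_iff by auto
  have rat: "c * q \<le> dist (w x) (w (x + \<sigma> * q))" if "q \<in> \<rat>" "0 < q" "q < inverse (real (Suc n))" for q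
  proof -
    have "ereal c \<le> ereal (dist (w x) (w (x + \<sigma> * q)) / q)"
      by (rule order_trans[OF less_imp_le[OF n]], rule INF_lower) (use that in auto)
    then show ?thesis using that by (simp add: divide_simps)
  qed
  show thesis
  proof (rule that[of "inverse (real (Suc n))"])
    fix h assume h: "0 < h" "h < inverse (real (Suc n))"
    show "c * h \<le> dist (w x) (w (x + \<sigma> * h))"
    proof (rule ccontr)
      let ?A = "{q. dist (w x) (w (x + \<sigma> * q)) < c * q} \<inter> {0<..<inverse (real (Suc n))}"
      assume "\<not> ?thesis"
      with h have "h \<in> ?A" by auto
      moreover have "open ?A"
        by (intro open_Int open_Collect_less continuous_intros continuous_on_compose2[OF w]) auto
      ultimately obtain e where e: "e > 0" "ball h e \<subseteq> ?A" by (meson open_contains_ball)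
      obtain q where "q \<in> \<rat>" "h < q" "q < h + e" using Rats_dense_in_real[of h "h + e"] e by auto
      moreover from this e have "q \<in> ?A" by (auto simp: dist_real_def subset_iff)
      ultimately show False using rat[of q] by auto
    qed
  qed simp
qed

lemma real_derivative_deviation:
  fixes F :: "real \<Rightarrow> real"
  assumes F: "(F has_real_derivative f) (at x)" and "e > 0"
  obtains d where "d > 0" "\<And>k. \<bar>k\<bar> < d \<Longrightarrow> \<bar>F (x + k) - F x - f * k\<bar> \<le> e * \<bar>k\<bar>"
proof -
  from F \<open>e > 0\<close> obtain d where "d > 0" and d: "\<And>y. \<bar>y - x\<bar> < d \<Longrightarrow> \<bar>F y - F x - f * (y - x)\<bar> \<le> e * \<bar>y - x\<bar>"
    unfolding has_field_derivative_def has_derivative_at_alt by (fastforce simp: real_norm_def)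
  from \<open>d > 0\<close> d[of "x + _"] show thesis by (intro that) auto
qed

section \<open>Curves with a fixed integrable majorant on a compact interval\<close>

locale dominated_curve =
  fixes w :: "real \<Rightarrow> 'a::metric_space" and m :: "real \<Rightarrow> real" and a b :: real
  assumes cont: "continuous_on UNIV w"
    and m_nonneg: "\<And>r. \<lbrakk>a \<le> r; r \<le> b\<rbrakk> \<Longrightarrow> 0 \<le> m r"
    and m_abs_int: "m absolutely_integrable_on {a..b}"
    and dist_le: "\<And>s t. \<lbrakk>a \<le> s; s \<le> t; t \<le> b\<rbrakk> \<Longrightarrow> dist (w s) (w t) \<le> integral {s..t} m"
begin

text \<open>An infinite lower speed is turned into \<open>0\<close>. Inside the interval this can
  only happen where \<open>majorant\<close> fails to have derivative \<open>m x\<close>, a null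
  set.\<close>

definition speed :: "real \<Rightarrow> real \<Rightarrow> real" where
  "speed \<sigma> x = real_of_ereal (lower_speed \<sigma> w x)"

definition majorant :: "real \<Rightarrow> real" where "majorant x = integral {a..x} m"
definition speed_integral :: "real \<Rightarrow> real \<Rightarrow> real" where "speed_integral \<sigma> x = integral {a..x} (speed \<sigma>)"

text \<open>The first condition makes the lower speed finite, so that \<open>speed\<close> is its
  true value; the second allows integrals of \<open>speed\<close> to be compared with its value at
  \<open>x\<close>.\<close>

definition regular :: "real \<Rightarrow> real \<Rightarrow> bool" where
  "regular \<sigma> x \<longleftrightarrow> (majorant has_real_derivative m x) (at x) \<and> (speed_integral \<sigma> has_real_derivative speed \<sigma> x) (at x)"

lemma m_int: "m integrable_on {a..b}"
  using m_abs_int absolutely_integrable_on_def by blast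

lemma speed_nonneg: "0 \<le> speed \<sigma> x"
  unfolding speed_def by (simp add: lower_speed_nonneg real_of_ereal_pos)

lemma borel_measurable_speed [measurable]: "speed \<sigma> \<in> borel_measurable borel"
  unfolding speed_def[abs_def] using borel_measurable_lower_speed[OF cont] by measurable

lemma dist_le_majorant: "dist (w x) (w y) \<le> \<bar>majorant y - majorant x\<bar>" if "x \<in> {a..b}" "y \<in> {a..b}" for x y
  using that dist_le[of x y] dist_le[of y x] integral_atLeastAtMost_diff[OF m_int, of x y] integral_atLeastAtMost_diff[OF m_int, of y x]
  by (cases "x \<le> y") (auto simp: majorant_def dist_commute)

text \<open>The curve moves no further than \<open>majorant\<close> does, and the latter has
  derivative \<open>m x\<close>. This bound also supplies the finiteness of the lower speed.\<close>

lemma lower_speed_le: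
  assumes M: "(majorant has_real_derivative m x) (at x)" and x: "x \<in> {a<..<b}" and \<sigma>: "\<bar>\<sigma>\<bar> = 1"
  shows "lower_speed \<sigma> w x \<le> ereal (m x)"
proof (rule ereal_le_epsilon2)
  fix e :: real assume "e > 0"
  obtain d where d: "d > 0" "\<And>k. \<bar>k\<bar> < d \<Longrightarrow> \<bar>majorant (x + k) - majorant x - m x * k\<bar> \<le> e * \<bar>k\<bar>"
    using real_derivative_deviation[OF M \<open>e > 0\<close>] by blast
  have "lower_speed \<sigma> w x \<le> ereal (m x + e)"
  proof (rule lower_speed_leI)
    show "0 < min d (min (x - a) (b - x))" using x d by simp
    fix h assume h: "0 < h" "h < min d (min (x - a) (b - x))"
    with \<sigma> have sh: "\<bar>\<sigma> * h\<bar> = h" by (simp add: abs_mult)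
    then have "dist (w x) (w (x + \<sigma> * h)) \<le> \<bar>majorant (x + \<sigma> * h) - majorant x\<bar>"
      using x h by (intro dist_le_majorant) (auto simp: abs_le_iff)
    also have "\<dots> \<le> \<bar>m x * (\<sigma> * h)\<bar> + e * h"
    proof -
      have "\<bar>majorant (x + \<sigma> * h) - majorant x - m x * (\<sigma> * h)\<bar> \<le> e * h"
        using d(2)[of "\<sigma> * h"] sh h by simp
      then show ?thesis by linarith
    qed
    also have "\<dots> = (m x + e) * h"
      unfolding abs_mult[of "m x"] sh using m_nonneg[of x] x by (simp add: distrib_right)
    finally show "dist (w x) (w (x + \<sigma> * h)) \<le> (m x + e) * h" .
  qed
  then show "lower_speed \<sigma> w x \<le> ereal (m x) + ereal e" by simp
qed

lemma lower_speed_eq_speed: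
  assumes M: "(majorant has_real_derivative m x) (at x)" and x: "x \<in> {a<..<b}" and \<sigma>: "\<bar>\<sigma>\<bar> = 1"
  shows "lower_speed \<sigma> w x = ereal (speed \<sigma> x)"
  using lower_speed_le[OF assms] lower_speed_nonneg[of \<sigma> w x]
  unfolding speed_def by (cases "lower_speed \<sigma> w x") auto

lemma negligible_not_majorant: "negligible {x \<in> {a<..<b}. \<not> (majorant has_real_derivative m x) (at x)}"
  unfolding majorant_def[abs_def] by (rule negligible_not_has_derivative_indefinite_integral[OF m_int])

lemma speed_abs_int: assumes \<sigma>: "\<bar>\<sigma>\<bar> = 1" shows "speed \<sigma> absolutely_integrable_on {a..b}"
proof -
  \<comment> \<open>The endpoints are added because differentiability was examined in the open
    interval only.\<close>
  let ?N = "{x \<in> {a<..<b}. \<not> (majorant has_real_derivative m x) (at x)} \<union> {a,b}"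
  have N: "negligible ?N" using negligible_not_majorant by (simp add: negligible_Un)
  have "integrable lebesgue (\<lambda>x. indicat_real {a..b} x *\<^sub>R speed \<sigma> x)"
  proof (rule Bochner_Integration.integrable_bound)
    show "integrable lebesgue (\<lambda>x. indicat_real {a..b} x *\<^sub>R m x)"
      using m_abs_int by (simp add: set_integrable_def)
    show "(\<lambda>x. indicat_real {a..b} x *\<^sub>R speed \<sigma> x) \<in> borel_measurable lebesgue"
      by (rule measurable_completion) measurable
    have "AE x in lebesgue. x \<notin> ?N"
      using N by (intro AE_not_in) (simp add: negligible_iff_null_sets)
    then show "AE x in lebesgue. norm (indicat_real {a..b} x *\<^sub>R speed \<sigma> x) \<le> norm (indicat_real {a..b} x *\<^sub>R m x)"
    proof eventually_elim
      case (elim x)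
      show ?case
      proof (cases "x \<in> {a..b}")
        case True
        with elim have "(majorant has_real_derivative m x) (at x)" "x \<in> {a<..<b}" by (auto simp: less_le)
        from lower_speed_le[OF this \<sigma>] lower_speed_eq_speed[OF this \<sigma>] have "speed \<sigma> x \<le> m x" by simp
        with speed_nonneg[of \<sigma> x] True show ?thesis by simp
      qed simp
    qed
  qed
  then show ?thesis by (simp add: set_integrable_def)
qed

lemma negligible_not_regular: "negligible {x \<in> {a<..<b}. \<not> regular \<sigma> x}" if \<sigma>: "\<bar>\<sigma>\<bar> = 1"
proof -
  have "negligible {x \<in> {a<..<b}. \<not> (speed_integral \<sigma> has_real_derivative speed \<sigma> x) (at x)}"
    unfolding speed_integral_def[abs_def]
    by (rule negligible_not_has_derivative_indefinite_integral) (use speed_abs_int[OF \<sigma>] absolutely_integrable_on_def in blast)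
  from negligible_Un[OF this negligible_not_majorant] show ?thesis
    by (rule negligible_subset) (auto simp: regular_def)
qed

text \<open>The function \<open>G\<close> below grows faster than the curve moves, at some small scale at every point: at
  regular points because of the derivative of the speed integral, and at the exceptional null set
  because \<open>V\<close> grows like the majorant on an open neighbourhood \<open>U\<close> of it.\<close>

lemma dist_le_integral_speed:
  assumes \<sigma>: "\<bar>\<sigma>\<bar> = 1" and st: "a < s" "s \<le> t" "t < b"
  shows "dist (w s) (w t) \<le> integral {s..t} (speed \<sigma>)"
proof (rule field_le_epsilon)
  fix e :: real assume "e > 0"
  \<comment> \<open>The term \<open>\<eta> * x\<close> of \<open>G\<close> costs
    \<open>\<eta> * (t - s)\<close> and \<open>V\<close> costs at most \<open>\<eta>\<close>, which
    makes \<open>e\<close> in total.\<close>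
  define \<eta> where "\<eta> = e / (t - s + 1)"
  have "\<eta> > 0" using \<open>e > 0\<close> st by (simp add: \<eta>_def)
  let ?N = "{x \<in> {a<..<b}. \<not> regular \<sigma> x}"
  have sp_int: "speed \<sigma> integrable_on {a..b}" using speed_abs_int[OF \<sigma>] absolutely_integrable_on_def by blast
  obtain U where U: "open U" "?N \<subseteq> U"
    "integral {a..b} (\<lambda>x. if x \<in> U then \<bar>m x\<bar> else 0) < \<eta>"
    "(\<lambda>x. if x \<in> U then \<bar>m x\<bar> else 0) integrable_on {a..b}"
    using negligible_open_superset_small_integral[OF m_abs_int negligible_not_regular[OF \<sigma>] \<open>\<eta> > 0\<close>] by blast
  define mU where "mU = (\<lambda>x. if x \<in> U then \<bar>m x\<bar> else 0)"
  have mU_int: "mU integrable_on {a..b}" using U by (simp add: mU_def)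
  have mU_nonneg: "0 \<le> mU x" for x by (simp add: mU_def)
  define V where "V = (\<lambda>x. integral {a..x} mU)"
  define G where "G = (\<lambda>x. speed_integral \<sigma> x + (\<eta> * x + V x))"
  have S_mono: "speed_integral \<sigma> x \<le> speed_integral \<sigma> y" and V_mono: "V x \<le> V y" if "a \<le> x" "x \<le> y" "y \<le> b" for x y
    unfolding speed_integral_def V_def using that mU_nonneg
    by (auto intro!: mono_indefinite_integral sp_int mU_int speed_nonneg)
  \<comment> \<open>All three summands of \<open>G\<close> are nondecreasing, so their increments
    cannot cancel. Absolute values cover both signs of \<open>\<sigma>\<close>.\<close>
  have G_ge: "\<bar>speed_integral \<sigma> y - speed_integral \<sigma> x\<bar> + \<eta> * \<bar>y - x\<bar> + \<bar>V y - V x\<bar> \<le> \<bar>G y - G x\<bar>"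
    if "x \<in> {a..b}" "y \<in> {a..b}" for x y
  proof (cases "x \<le> y")
    case True
    then have "\<eta> * x \<le> \<eta> * y" using \<open>\<eta> > 0\<close> by simp
    with S_mono[of x y] V_mono[of x y] True that show ?thesis by (simp add: G_def algebra_simps)
  next
    case False
    then have "\<eta> * y \<le> \<eta> * x" using \<open>\<eta> > 0\<close> by simp
    with S_mono[of y x] V_mono[of y x] False that show ?thesis by (simp add: G_def algebra_simps)
  qed
  have G_mono: "G x \<le> G y" if "a \<le> x" "x \<le> y" "y \<le> b" for x y
    using S_mono[of x y] V_mono[of x y] that \<open>\<eta> > 0\<close> by (simp add: G_def add_mono)
  have "continuous_on {a..b} G"
    unfolding G_def speed_integral_def V_def
    by (intro continuous_intros indefinite_integral_continuous_1 sp_int mU_int)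
  then have G_cont: "continuous_on {s..t} G" by (rule continuous_on_subset) (use st in auto)
  have w_cont: "continuous_on {s..t} w" by (rule continuous_on_subset[OF cont]) auto
  have step: "\<exists>h>0. h < d \<and> x + \<sigma> * h \<in> {a..b} \<and> dist (w x) (w (x + \<sigma> * h)) \<le> \<bar>G (x + \<sigma> * h) - G x\<bar>"
    if x: "x \<in> {a<..<b}" and "d > 0" for x d
  proof -
    define d0 where "d0 = min d (min (x - a) (b - x))"
    have d0: "d0 > 0" using x \<open>d > 0\<close> by (simp add: d0_def)
    have dom: "x + \<sigma> * h \<in> {a..b}" "\<bar>\<sigma> * h\<bar> = h" if "0 < h" "h < d0" for h
    proof -
      show "\<bar>\<sigma> * h\<bar> = h" using \<sigma> that by (simp add: abs_mult)
      then show "x + \<sigma> * h \<in> {a..b}" using that by (auto simp: d0_def abs_le_iff)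
    qed
    show ?thesis
    proof (cases "regular \<sigma> x")
      case True
      then have lim: "lower_speed \<sigma> w x = ereal (speed \<sigma> x)"
        and der: "(speed_integral \<sigma> has_real_derivative speed \<sigma> x) (at x)"
        using lower_speed_eq_speed[OF _ x \<sigma>] by (auto simp: regular_def)
      from \<open>\<eta> > 0\<close> have "\<eta> / 2 > 0" by simp
      \<comment> \<open>One half of \<open>\<eta>\<close> pays for the excess over the lower speed,
        the other for the error of the derivative; the linear term of \<open>G\<close> provides
        both.\<close>
      obtain d1 where d1: "d1 > 0"
        "\<And>k. \<bar>k\<bar> < d1 \<Longrightarrow> \<bar>speed_integral \<sigma> (x + k) - speed_integral \<sigma> x - speed \<sigma> x * k\<bar> \<le> \<eta> / 2 * \<bar>k\<bar>"
        using real_derivative_deviation[OF der \<open>\<eta> / 2 > 0\<close>] by blast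
      have "lower_speed \<sigma> w x < ereal (speed \<sigma> x + \<eta> / 2)" "min d0 d1 > 0"
        using lim d0 d1 \<open>\<eta> > 0\<close> by auto
      then obtain h where h: "0 < h" "h < min d0 d1" "dist (w x) (w (x + \<sigma> * h)) \<le> (speed \<sigma> x + \<eta> / 2) * h"
        by (rule lower_speed_less_obtains)
      let ?y = "x + \<sigma> * h"
      have y: "?y \<in> {a..b}" "\<bar>\<sigma> * h\<bar> = h" using dom h by auto
      have "\<bar>speed_integral \<sigma> ?y - speed_integral \<sigma> x - speed \<sigma> x * (\<sigma> * h)\<bar> \<le> \<eta> / 2 * h"
        using d1(2)[of "\<sigma> * h"] h y by simp
      moreover have "\<bar>speed \<sigma> x * (\<sigma> * h)\<bar> = speed \<sigma> x * h"
        unfolding abs_mult[of "speed \<sigma> x"] y(2) using speed_nonneg[of \<sigma> x] by simp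
      ultimately have "speed \<sigma> x * h \<le> \<bar>speed_integral \<sigma> ?y - speed_integral \<sigma> x\<bar> + \<eta> / 2 * h"
        by linarith
      then have "dist (w x) (w ?y) \<le> \<bar>speed_integral \<sigma> ?y - speed_integral \<sigma> x\<bar> + \<eta> * h"
        using h(3) by (simp add: algebra_simps)
      also have "\<dots> \<le> \<bar>G ?y - G x\<bar>" using G_ge[of x ?y] y x by simp
      finally show ?thesis using h y by (auto simp: d0_def)
    next
      case False
      with x U have "x \<in> U" by blast
      with \<open>open U\<close> obtain r where r: "r > 0" "ball x r \<subseteq> U" by (meson open_contains_ball)
      define h where "h = min d0 r / 2"
      have h: "0 < h" "h < d0" "h < r" using d0 r by (auto simp: h_def)
      let ?y = "x + \<sigma> * h"
      have y: "?y \<in> {a..b}" "\<bar>\<sigma> * h\<bar> = h" using dom h by auto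
      have eq: "majorant q - majorant p = V q - V p" if "p \<le> q" "p \<in> {a..b}" "q \<in> {a..b}" "{p..q} \<subseteq> ball x r" for p q
      proof -
        have "integral {p..q} m = integral {p..q} mU"
        proof (rule Henstock_Kurzweil_Integration.integral_cong)
          fix z assume z: "z \<in> {p..q}"
          with that r have "z \<in> U" "z \<in> {a..b}" by (auto simp: subset_iff)
          then show "m z = mU z" using m_nonneg[of z] by (simp add: mU_def)
        qed
        with that show ?thesis
          using integral_atLeastAtMost_diff[OF m_int, of p q] integral_atLeastAtMost_diff[OF mU_int, of p q] by (simp add: majorant_def V_def)
      qed
      have "dist (w x) (w ?y) \<le> \<bar>majorant ?y - majorant x\<bar>" using y x by (intro dist_le_majorant) auto
      also have "\<dots> = \<bar>V ?y - V x\<bar>"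
      proof (cases "x \<le> ?y")
        case True
        then show ?thesis using eq[of x ?y] y x h by (auto simp: dist_real_def subset_iff)
      next
        case False
        then show ?thesis using eq[of ?y x] y x h by (auto simp: dist_real_def subset_iff abs_minus_commute)
      qed
      also have "\<dots> \<le> \<bar>G ?y - G x\<bar>" using G_ge[of x ?y] y x \<open>\<eta> > 0\<close> by (smt (verit) mult_nonneg_nonneg greaterThanLessThan_iff atLeastAtMost_iff)
      finally show ?thesis using h y by (auto simp: d0_def)
    qed
  qed
  have "dist (w s) (w t) \<le> G t - G s"
  proof -
    consider "\<sigma> = 1" | "\<sigma> = -1" using \<sigma> by linarith
    then show ?thesis
    proof cases
      case 1
      show ?thesis
      proof (rule dist_le_of_local_increments[OF \<open>s \<le> t\<close> w_cont G_cont])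
        fix x assume x: "s \<le> x" "x < t"
        with step[of x "t - x"] st 1 obtain h where h: "h > 0" "h < t - x" "dist (w x) (w (x + h)) \<le> \<bar>G (x + h) - G x\<bar>"
          by auto
        with G_mono[of x "x + h"] x st show "\<exists>h>0. x + h \<le> t \<and> dist (w x) (w (x + h)) \<le> G (x + h) - G x"
          by (intro exI[of _ h]) auto
      qed
    next
      case 2
      show ?thesis
      proof (rule dist_le_of_local_increments_left[OF \<open>s \<le> t\<close> w_cont G_cont])
        fix x assume x: "s < x" "x \<le> t"
        with step[of x "x - s"] st 2 obtain h where h: "h > 0" "h < x - s" "dist (w x) (w (x - h)) \<le> \<bar>G (x - h) - G x\<bar>"
          by auto
        with G_mono[of "x - h" x] x st show "\<exists>h>0. s \<le> x - h \<and> dist (w (x - h)) (w x) \<le> G x - G (x - h)"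
          by (intro exI[of _ h]) (auto simp: dist_commute)
      qed
    qed
  qed
  also have "G t - G s \<le> integral {s..t} (speed \<sigma>) + e"
  proof -
    have "V b < \<eta>" using U by (simp add: V_def mU_def)
    then have "V t - V s \<le> \<eta>" using V_mono[of t b] V_mono[of a s] st by (simp add: V_def)
    moreover have "\<eta> * (t - s) + \<eta> = e"
    proof -
      have "\<eta> * (t - s + 1) = e" using st by (simp add: \<eta>_def)
      then show ?thesis by (simp add: distrib_left)
    qed
    moreover have "integral {s..t} (speed \<sigma>) = speed_integral \<sigma> t - speed_integral \<sigma> s"
      using integral_atLeastAtMost_diff[OF sp_int, of s t] st by (simp add: speed_integral_def)
    ultimately show ?thesis by (simp add: G_def algebra_simps)
  qed
  finally show "dist (w s) (w t) \<le> integral {s..t} (speed \<sigma>) + e" .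
qed

text \<open>Although \<open>speed \<sigma>\<close> looks to one side only, its integral bounds
  distances between any two interior points. Differentiating that integral at \<open>x\<close>
  therefore yields an upper bound on both sides.\<close>

lemma dist_le_near_regular:
  assumes \<sigma>: "\<bar>\<sigma>\<bar> = 1" and reg: "regular \<sigma> x" and x: "x \<in> {a<..<b}" and "e > 0"
  obtains d where "d > 0" "\<And>k. \<bar>k\<bar> < d \<Longrightarrow> dist (w (x + k)) (w x) \<le> (speed \<sigma> x + e) * \<bar>k\<bar>"
proof -
  have der: "(speed_integral \<sigma> has_real_derivative speed \<sigma> x) (at x)" using reg by (simp add: regular_def)
  obtain d1 where d1: "d1 > 0"
    "\<And>k. \<bar>k\<bar> < d1 \<Longrightarrow> \<bar>speed_integral \<sigma> (x + k) - speed_integral \<sigma> x - speed \<sigma> x * k\<bar> \<le> e * \<bar>k\<bar>"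
    using real_derivative_deviation[OF der \<open>e > 0\<close>] by blast
  have sp_int: "speed \<sigma> integrable_on {a..b}" using speed_abs_int[OF \<sigma>] absolutely_integrable_on_def by blast
  show thesis
  proof (rule that)
    show "0 < min d1 (min (x - a) (b - x))" using d1 x by simp
    fix k assume k: "\<bar>k\<bar> < min d1 (min (x - a) (b - x))"
    then have xk: "x + k \<in> {a<..<b}" by (auto simp: abs_less_iff)
    have "dist (w (x + k)) (w x) \<le> \<bar>speed_integral \<sigma> (x + k) - speed_integral \<sigma> x\<bar>"
    proof (cases "0 \<le> k")
      case True
      then show ?thesis
        using dist_le_integral_speed[OF \<sigma>, of x "x + k"] integral_atLeastAtMost_diff[OF sp_int, of x "x + k"] x xk
        by (simp add: speed_integral_def dist_commute)
    next
      case False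
      then show ?thesis
        using dist_le_integral_speed[OF \<sigma>, of "x + k" x] integral_atLeastAtMost_diff[OF sp_int, of "x + k" x] x xk
        by (simp add: speed_integral_def)
    qed
    also have "\<dots> \<le> \<bar>speed \<sigma> x * k\<bar> + e * \<bar>k\<bar>" using d1(2)[of k] k by linarith
    also have "\<dots> = (speed \<sigma> x + e) * \<bar>k\<bar>"
      using speed_nonneg[of \<sigma> x] by (simp add: abs_mult algebra_simps)
    finally show "dist (w (x + k)) (w x) \<le> (speed \<sigma> x + e) * \<bar>k\<bar>" .
  qed
qed

lemma dist_ge_near_regular:
  assumes \<sigma>: "\<bar>\<sigma>\<bar> = 1" and reg: "regular \<sigma> x" and x: "x \<in> {a<..<b}" and "e > 0"
  obtains d where "d > 0" "\<And>h. \<lbrakk>0 < h; h < d\<rbrakk> \<Longrightarrow> (speed \<sigma> x - e) * h \<le> dist (w (x + \<sigma> * h)) (w x)"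
proof -
  have "ereal (speed \<sigma> x - e) < lower_speed \<sigma> w x"
    using lower_speed_eq_speed[OF _ x \<sigma>] reg \<open>e > 0\<close> by (simp add: regular_def)
  from lower_speed_greater_obtains[OF cont this] that show thesis by (metis dist_commute)
qed

text \<open>At \<open>x + \<sigma> * h\<close> the one-sided lower bound for \<open>\<sigma>\<close>
  meets the two-sided upper bound for \<open>\<tau>\<close>. Used in both directions, this
  identifies the left and right speeds.\<close>

lemma speed_le_speed:
  assumes \<sigma>: "\<bar>\<sigma>\<bar> = 1" "regular \<sigma> x" and \<tau>: "\<bar>\<tau>\<bar> = 1" "regular \<tau> x" and x: "x \<in> {a<..<b}"
  shows "speed \<sigma> x \<le> speed \<tau> x"
proof (rule field_le_epsilon)
  fix e :: real assume "e > 0"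
  then have "e / 2 > 0" by simp
  obtain d1 where d1: "d1 > 0" "\<And>k. \<bar>k\<bar> < d1 \<Longrightarrow> dist (w (x + k)) (w x) \<le> (speed \<tau> x + e / 2) * \<bar>k\<bar>"
    using dist_le_near_regular[OF \<tau> x \<open>e / 2 > 0\<close>] by blast
  obtain d2 where d2: "d2 > 0" "\<And>h. \<lbrakk>0 < h; h < d2\<rbrakk> \<Longrightarrow> (speed \<sigma> x - e / 2) * h \<le> dist (w (x + \<sigma> * h)) (w x)"
    using dist_ge_near_regular[OF \<sigma> x \<open>e / 2 > 0\<close>] by blast
  define h where "h = min d1 d2 / 2"
  have h: "0 < h" "h < d1" "h < d2" using d1 d2 by (auto simp: h_def)
  have "\<bar>\<sigma> * h\<bar> = h" using \<sigma> h by (simp add: abs_mult)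
  with d1(2)[of "\<sigma> * h"] h have "dist (w (x + \<sigma> * h)) (w x) \<le> (speed \<tau> x + e / 2) * h" by simp
  with d2(2)[OF h(1,3)] have "(speed \<sigma> x - e / 2) * h \<le> (speed \<tau> x + e / 2) * h" by (rule order_trans)
  then have "speed \<sigma> x - e / 2 \<le> speed \<tau> x + e / 2" using h(1) by (rule mult_right_le_imp_le)
  then show "speed \<sigma> x \<le> speed \<tau> x + e" by simp
qed

text \<open>Since both one-sided speeds agree, the lower bounds from the right and from the left
  match the common upper bound.\<close>

lemma metric_speed_tendsto:
  assumes reg: "regular 1 x" "regular (-1) x" and x: "x \<in> {a<..<b}"
  shows "((\<lambda>h. dist (w (x + h)) (w x) / \<bar>h\<bar>) \<longlongrightarrow> speed 1 x) (at 0)"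
proof -
  have eq: "speed (-1) x = speed 1 x"
    using speed_le_speed[of 1 x "-1"] speed_le_speed[of "-1" x 1] reg x by simp
  show ?thesis unfolding LIM_eq
  proof (intro allI impI)
    fix r :: real assume "r > 0"
    then have "r / 2 > 0" by simp
    obtain d1 where d1: "d1 > 0" "\<And>k. \<bar>k\<bar> < d1 \<Longrightarrow> dist (w (x + k)) (w x) \<le> (speed 1 x + r / 2) * \<bar>k\<bar>"
      using dist_le_near_regular[OF _ reg(1) x \<open>r / 2 > 0\<close>] by auto
    obtain d2 where d2: "d2 > 0" "\<And>h. \<lbrakk>0 < h; h < d2\<rbrakk> \<Longrightarrow> (speed 1 x - r / 2) * h \<le> dist (w (x + 1 * h)) (w x)"
      using dist_ge_near_regular[OF _ reg(1) x \<open>r / 2 > 0\<close>] by auto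
    obtain d3 where d3: "d3 > 0" "\<And>h. \<lbrakk>0 < h; h < d3\<rbrakk> \<Longrightarrow> (speed 1 x - r / 2) * h \<le> dist (w (x + (-1) * h)) (w x)"
      using dist_ge_near_regular[OF _ reg(2) x \<open>r / 2 > 0\<close>] eq by auto
    show "\<exists>s>0. \<forall>h. h \<noteq> 0 \<and> norm (h - 0) < s \<longrightarrow> norm (dist (w (x + h)) (w x) / \<bar>h\<bar> - speed 1 x) < r"
    proof (intro exI[of _ "min d1 (min d2 d3)"] conjI allI impI)
      show "0 < min d1 (min d2 d3)" using d1 d2 d3 by simp
      fix h :: real assume h: "h \<noteq> 0 \<and> norm (h - 0) < min d1 (min d2 d3)"
      have up: "dist (w (x + h)) (w x) \<le> (speed 1 x + r / 2) * \<bar>h\<bar>" using d1(2)[of h] h by simp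
      have lo: "(speed 1 x - r / 2) * \<bar>h\<bar> \<le> dist (w (x + h)) (w x)"
        using d2(2)[of h] d3(2)[of "- h"] h by (cases "h > 0") auto
      from up h have "dist (w (x + h)) (w x) / \<bar>h\<bar> \<le> speed 1 x + r / 2" by (simp add: pos_divide_le_eq)
      moreover from lo h have "speed 1 x - r / 2 \<le> dist (w (x + h)) (w x) / \<bar>h\<bar>" by (simp add: pos_le_divide_eq)
      ultimately show "norm (dist (w (x + h)) (w x) / \<bar>h\<bar> - speed 1 x) < r"
        unfolding real_norm_def using \<open>r > 0\<close> by linarith
    qed
  qed
qed

lemma negligible_not_metric_speed:
  "negligible {x \<in> {a<..<b}. \<not> ((\<lambda>h. dist (w (x + h)) (w x) / \<bar>h\<bar>) \<longlongrightarrow> speed 1 x) (at 0)}"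
  using negligible_Un[OF negligible_not_regular[of 1] negligible_not_regular[of "-1"]]
  by (rule negligible_subset) (use metric_speed_tendsto in auto)

end

subsection \<open>Locally absolutely continuous curves and gradient flows\<close>

lemma metric_derivative_eqI:
  "((\<lambda>h. dist (v (t + h)) (v t) / \<bar>h\<bar>) \<longlongrightarrow> l) (at 0) \<Longrightarrow> metric_derivative v t = l"
  unfolding metric_derivative_def by (rule tendsto_Lim) simp_all

lemma metric_derivative_shift: "metric_derivative (\<lambda>t. v (T + t)) r = metric_derivative v (T + r)"
  by (simp add: metric_derivative_def add.assoc)

lemma locally_abs_continuous_majorant:
  assumes "locally_abs_continuous v"
  obtains m where "\<And>r. r > 0 \<Longrightarrow> 0 \<le> m r"
    and "\<And>a b. 0 < a \<Longrightarrow> m absolutely_integrable_on {a..b}"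
    and "\<And>s t. \<lbrakk>0 < s; s \<le> t\<rbrakk> \<Longrightarrow> dist (v s) (v t) \<le> integral {s..t} m"
proof -
  obtain m where m: "\<forall>r>0. 0 \<le> m r" "\<forall>a b. 0 < a \<and> a \<le> b \<longrightarrow> set_integrable lebesgue {a..b} m"
    "\<forall>s t. 0 < s \<and> s \<le> t \<longrightarrow> dist (v t) (v s) \<le> (LINT r:{s..t}|lebesgue. m r)"
    using assms unfolding locally_abs_continuous_def by blast
  show thesis
  proof
    show "0 \<le> m r" if "r > 0" for r using m that by blast
    show "m absolutely_integrable_on {a..b}" if "0 < a" for a b
      using m that by (cases "a \<le> b") auto
    show "dist (v s) (v t) \<le> integral {s..t} m" if "0 < s" "s \<le> t" for s t
      using m that set_lebesgue_integral_eq_integral(2)[of "{s..t}" m] by (metis dist_commute)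
  qed
qed

lemma locally_abs_continuous_imp_isCont:
  assumes v: "locally_abs_continuous v" and "0 < t"
  shows "isCont v t"
proof -
  obtain m where m: "\<And>r. r > 0 \<Longrightarrow> 0 \<le> m r" "\<And>a b. 0 < a \<Longrightarrow> m absolutely_integrable_on {a..b}"
    "\<And>s t. \<lbrakk>0 < s; s \<le> t\<rbrakk> \<Longrightarrow> dist (v s) (v t) \<le> integral {s..t} m"
    using locally_abs_continuous_majorant[OF v] by blast
  define a where "a = t / 2"
  define b where "b = t + 1"
  have ab: "0 < a" "a < t" "t < b" using \<open>0 < t\<close> by (auto simp: a_def b_def)
  have m_int: "m integrable_on {a..b}" using m(2)[OF ab(1)] absolutely_integrable_on_def by blast
  define F where "F = (\<lambda>x. integral {a..x} m)"
  have diff: "integral {x..y} m = F y - F x" if "a \<le> x" "x \<le> y" "y \<le> b" for x y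
    unfolding F_def by (rule integral_atLeastAtMost_diff[OF m_int that])
  have "continuous_on {a..b} F" unfolding F_def by (rule indefinite_integral_continuous_1[OF m_int])
  then have "isCont F t" using ab by (intro continuous_on_interior) auto
  then have "((\<lambda>y. \<bar>F y - F t\<bar>) \<longlongrightarrow> 0) (at t)"
    by (simp add: isCont_def LIM_zero tendsto_rabs_zero)
  moreover have "eventually (\<lambda>y. norm (dist (v y) (v t)) \<le> \<bar>F y - F t\<bar>) (at t)"
  proof -
    have "eventually (\<lambda>y. y \<in> {a<..<b}) (at t)" using ab by (intro eventually_at_in_open') auto
    then show ?thesis
    proof eventually_elim
      case (elim y)
      then show ?case
        using m(3)[of y t] m(3)[of t y] diff[of y t] diff[of t y] ab by (cases "y \<le> t") (auto simp: dist_commute)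
    qed
  qed
  ultimately have "((\<lambda>y. dist (v y) (v t)) \<longlongrightarrow> 0) (at t)" by (rule Lim_null_comparison[rotated])
  then show ?thesis unfolding isCont_def by (rule tendsto_dist_iff[THEN iffD2])
qed

text \<open>\<open>D\<close> is a Borel representative: \<open>metric_derivative\<close> has
  unspecified values on a null set, and the later additivity of integrals requires
  measurability.\<close>

theorem locally_abs_continuous_metric_derivative:
  assumes v: "locally_abs_continuous v" and st: "0 < s" "s \<le> t"
  obtains D :: "real \<Rightarrow> real" where "D \<in> borel_measurable borel" "\<And>r. 0 \<le> D r"
    "AE r in lebesgue. r \<in> {s..t} \<longrightarrow> metric_derivative v r = D r"
    "ennreal (dist (v s) (v t)) \<le> (\<integral>\<^sup>+r\<in>{s..t}. ennreal (D r) \<partial>lebesgue)"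
proof -
  obtain m where m: "\<And>r. r > 0 \<Longrightarrow> 0 \<le> m r" "\<And>a b. 0 < a \<Longrightarrow> m absolutely_integrable_on {a..b}"
    "\<And>s t. \<lbrakk>0 < s; s \<le> t\<rbrakk> \<Longrightarrow> dist (v s) (v t) \<le> integral {s..t} m"
    using locally_abs_continuous_majorant[OF v] by blast
  \<comment> \<open>The margin around \<open>{s..t}\<close> places it in the open interval where the
    limit was obtained, while \<open>a\<close> remains positive.\<close>
  define a where "a = s / 2"
  define b where "b = t + 1"
  have ab: "0 < a" "a < s" "t < b" using st by (auto simp: a_def b_def)
  \<comment> \<open>Clamping the time extends the curve by constants to one that is continuous on
    the whole real line, as the locale demands.\<close>
  define w where "w = (\<lambda>x. v (max a (min b x)))"
  have w_eq: "w x = v x" if "x \<in> {a..b}" for x using that by (simp add: w_def)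
  have "continuous_on {0<..} v"
    using locally_abs_continuous_imp_isCont[OF v] by (intro continuous_at_imp_continuous_on) auto
  then have "continuous_on UNIV w" unfolding w_def
    by (rule continuous_on_compose2) (use ab in \<open>auto intro!: continuous_intros\<close>)
  then interpret dominated_curve w m a b
    using m ab by unfold_locales (auto simp: w_eq)
  show thesis
  proof (rule that[of "speed 1"])
    show "speed 1 \<in> borel_measurable borel" by simp
    show "0 \<le> speed 1 r" for r by (rule speed_nonneg)
    have "AE r in lebesgue. r \<notin> {x \<in> {a<..<b}. \<not> ((\<lambda>h. dist (w (x + h)) (w x) / \<bar>h\<bar>) \<longlongrightarrow> speed 1 x) (at 0)}"
      using negligible_not_metric_speed by (intro AE_not_in) (simp add: negligible_iff_null_sets)
    then show "AE r in lebesgue. r \<in> {s..t} \<longrightarrow> metric_derivative v r = speed 1 r"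
    proof eventually_elim
      case (elim r)
      show ?case
      proof (intro impI metric_derivative_eqI)
        assume "r \<in> {s..t}"
        with ab have r: "r \<in> {a<..<b}" by auto
        with elim have "((\<lambda>h. dist (w (r + h)) (w r) / \<bar>h\<bar>) \<longlongrightarrow> speed 1 r) (at 0)" by auto
        moreover have "eventually (\<lambda>h. dist (w (r + h)) (w r) / \<bar>h\<bar> = dist (v (r + h)) (v r) / \<bar>h\<bar>) (at 0)"
        proof -
          have "eventually (\<lambda>h. h \<in> {a - r<..<b - r}) (at 0)" using r by (intro eventually_at_in_open') auto
          then show ?thesis
            by eventually_elim (use r in \<open>auto simp: w_eq\<close>)
        qed
        ultimately show "((\<lambda>h. dist (v (r + h)) (v r) / \<bar>h\<bar>) \<longlongrightarrow> speed 1 r) (at 0)"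
          by (rule Lim_transform_eventually)
      qed
    qed
    have "speed 1 integrable_on {a..b}" using speed_abs_int[of 1] absolutely_integrable_on_def by auto
    then have "speed 1 integrable_on {s..t}" by (rule integrable_on_subinterval) (use ab in auto)
    then have "(\<integral>\<^sup>+r\<in>{s..t}. ennreal (speed 1 r) \<partial>lborel) = ennreal (integral {s..t} (speed 1))"
      by (intro nn_integral_has_integral_lebesgue' speed_nonneg) (rule integrable_integral)
    moreover have "dist (v s) (v t) \<le> integral {s..t} (speed 1)"
      using dist_le_integral_speed[of 1 s t] ab st by (simp add: w_eq)
    ultimately show "ennreal (dist (v s) (v t)) \<le> (\<integral>\<^sup>+r\<in>{s..t}. ennreal (speed 1 r) \<partial>lebesgue)"
      by (simp add: nn_integral_completion ennreal_leI)
  qed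
qed

text \<open>No measurability of \<open>f\<close>: the definition of a gradient flow does not provide it for the integrands
  of the energy inequality.\<close>

lemma nn_integral_lborel_shift:
  fixes f :: "real \<Rightarrow> ennreal"
  shows "(\<integral>\<^sup>+x. f (c + x) \<partial>lborel) = (\<integral>\<^sup>+x. f x \<partial>lborel)"
proof -
  \<comment> \<open>The integral is a supremum over simple functions below the integrand. These are
    measurable, so the change of variables applies to each of them.\<close>
  have le: "(\<integral>\<^sup>+x. f (c + x) \<partial>lborel) \<le> (\<integral>\<^sup>+x. f x \<partial>lborel)" for f :: "real \<Rightarrow> ennreal" and c
    unfolding nn_integral_def[of lborel "\<lambda>x. f (c + x)"]
  proof (rule SUP_least)
    fix g assume "g \<in> {g. simple_function lborel g \<and> g \<le> (\<lambda>x. f (c + x))}"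
    then have g: "simple_function lborel g" "\<And>x. g x \<le> f (c + x)" by (auto simp: le_fun_def)
    have meas: "g \<in> borel_measurable borel" using borel_measurable_simple_function[OF g(1)] by simp
    have "integral\<^sup>S lborel g = (\<integral>\<^sup>+x. g x \<partial>lborel)" by (rule nn_integral_eq_simple_integral[symmetric, OF g(1)])
    also have "\<dots> = (\<integral>\<^sup>+x. g x \<partial>distr lborel borel ((+) (- c)))" by (simp add: lborel_distr_plus)
    also have "\<dots> = (\<integral>\<^sup>+x. g (- c + x) \<partial>lborel)" by (rule nn_integral_distr) (use meas in auto)
    also have "\<dots> \<le> (\<integral>\<^sup>+x. f x \<partial>lborel)"
    proof (rule nn_integral_mono)
      show "g (- c + x) \<le> f x" for x using g(2)[of "- c + x"] by simp
    qed
    finally show "integral\<^sup>S lborel g \<le> (\<integral>\<^sup>+x. f x \<partial>lborel)" .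
  qed
  show ?thesis
  proof (rule antisym[OF le])
    show "(\<integral>\<^sup>+x. f x \<partial>lborel) \<le> (\<integral>\<^sup>+x. f (c + x) \<partial>lborel)"
      using le[of "\<lambda>x. f (c + x)" "- c"] by simp
  qed
qed

lemma oriented_nn_integral_shift:
  "oriented_nn_integral (\<lambda>r. f (c + r)) s t = oriented_nn_integral f (c + s) (c + t)"
proof -
  have "(\<integral>\<^sup>+r\<in>{p..q}. f (c + r) \<partial>lebesgue) = (\<integral>\<^sup>+r\<in>{c + p..c + q}. f r \<partial>lebesgue)" for p q
  proof -
    have "indicator {p..q} r = (indicator {c + p..c + q} (c + r) :: ennreal)" for r by (simp add: indicator_def)
    then show ?thesis
      unfolding nn_integral_completion
      using nn_integral_lborel_shift[of "\<lambda>r. f r * indicator {c + p..c + q} r" c] by simp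
  qed
  then show ?thesis by (simp add: oriented_nn_integral_def)
qed

lemma locally_abs_continuous_shift:
  assumes v: "locally_abs_continuous v" and "0 \<le> T"
  shows "locally_abs_continuous (\<lambda>t. v (T + t))"
proof -
  obtain m where m: "\<And>r. r > 0 \<Longrightarrow> 0 \<le> m r" "\<And>a b. 0 < a \<Longrightarrow> m absolutely_integrable_on {a..b}"
    "\<And>s t. \<lbrakk>0 < s; s \<le> t\<rbrakk> \<Longrightarrow> dist (v s) (v t) \<le> integral {s..t} m"
    using locally_abs_continuous_majorant[OF v] by blast
  have shift: "((\<lambda>r. m (T + r)) has_integral integral {T + p..T + q} m) {p..q}" if "0 < p" for p q
  proof -
    have "m integrable_on {T + p..T + q}" using m(2)[of "T + p" "T + q"] that \<open>0 \<le> T\<close> absolutely_integrable_on_def by auto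
    then have "(m has_integral integral {T + p..T + q} m) (cbox (T + p) (T + q))"
      by (simp add: integrable_integral)
    from has_integral_affinity[OF this, of 1 T] show ?thesis
      by (simp add: add.commute image_affinity_atLeastAtMost)
  qed
  show ?thesis unfolding locally_abs_continuous_def
  proof (intro exI[of _ "\<lambda>r. m (T + r)"] conjI allI impI)
    show "0 \<le> m (T + r)" if "r > 0" for r using m(1)[of "T + r"] that \<open>0 \<le> T\<close> by simp
    have abs: "(\<lambda>r. m (T + r)) absolutely_integrable_on {p..q}" if "0 < p" for p q
      by (rule nonnegative_absolutely_integrable_1) (use shift[OF that] m(1) that \<open>0 \<le> T\<close> in auto)
    then show "set_integrable lebesgue {p..q} (\<lambda>r. m (T + r))" if "0 < p \<and> p \<le> q" for p q using that by blast
    show "dist (v (T + t)) (v (T + s)) \<le> (LINT r:{s..t}|lebesgue. m (T + r))" if "0 < s \<and> s \<le> t" for s t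
      using m(3)[of "T + s" "T + t"] that \<open>0 \<le> T\<close> integral_unique[OF shift[of s t]]
        set_lebesgue_integral_eq_integral(2)[OF abs[of s t]] by (simp add: dist_commute)
  qed
qed

lemma gradient_flow_shift:
  assumes v: "gradient_flow \<Phi> g v" and "0 \<le> T"
  shows "gradient_flow \<Phi> g (\<lambda>t. v (T + t))"
  unfolding gradient_flow_def
proof (intro conjI allI impI)
  show "locally_abs_continuous (\<lambda>t. v (T + t))"
    using v \<open>0 \<le> T\<close> by (intro locally_abs_continuous_shift) (auto simp: gradient_flow_def)
  show "v (T + t) \<in> dom_fun \<Phi>" if "t > 0" for t
    using v that \<open>0 \<le> T\<close> by (auto simp: gradient_flow_def)
  show "\<Phi> (v (T + t)) - \<Phi> (v (T + s)) \<le>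
          - (ereal (1/2) * oriented_nn_integral (\<lambda>r. (ennreal (metric_derivative (\<lambda>t. v (T + t)) r))\<^sup>2) s t)
          - (ereal (1/2) * oriented_nn_integral (\<lambda>r. (e2ennreal (g (v (T + r))))\<^sup>2) s t)" if "s > 0" "t > 0" for s t
  proof -
    have "\<Phi> (v (T + t)) - \<Phi> (v (T + s)) \<le>
          - (ereal (1/2) * oriented_nn_integral (\<lambda>r. (ennreal (metric_derivative v r))\<^sup>2) (T + s) (T + t))
          - (ereal (1/2) * oriented_nn_integral (\<lambda>r. (e2ennreal (g (v r)))\<^sup>2) (T + s) (T + t))"
      using v that \<open>0 \<le> T\<close> unfolding gradient_flow_def by (meson add_nonneg_pos)
    then show ?thesis
      unfolding metric_derivative_shift[of v T]
        oriented_nn_integral_shift[of "\<lambda>r. (ennreal (metric_derivative v r))\<^sup>2" T s t, symmetric]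
        oriented_nn_integral_shift[of "\<lambda>r. (e2ennreal (g (v r)))\<^sup>2" T s t, symmetric] .
  qed
qed

section \<open>Energy dissipation and restarting of flows\<close>

text \<open>The slope bound is demanded before \<open>t\<close> only, because \<open>t\<close> will
  be the time of arrival in the set of Ekeland points, where it may fail.\<close>

lemma gradient_flow_energy_drop:
  assumes v: "gradient_flow \<Phi> g v" and fin: "\<And>x. \<Phi> x \<noteq> -\<infinity>" and st: "0 < s" "s \<le> t" and "0 \<le> c"
    and g: "\<And>r. \<lbrakk>s \<le> r; r < t\<rbrakk> \<Longrightarrow> ereal c \<le> g (v r)"
  shows "\<Phi> (v t) + ereal (c\<^sup>2 / 2 * (t - s)) \<le> \<Phi> (v s)"
    and "\<Phi> (v t) + ereal (c * dist (v s) (v t)) \<le> \<Phi> (v s)"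
proof -
  let ?A = "\<integral>\<^sup>+r\<in>{s..t}. (ennreal (metric_derivative v r))\<^sup>2 \<partial>lebesgue"
  let ?B = "\<integral>\<^sup>+r\<in>{s..t}. (e2ennreal (g (v r)))\<^sup>2 \<partial>lebesgue"
  have dom: "v s \<in> dom_fun \<Phi>" "v t \<in> dom_fun \<Phi>" and lac: "locally_abs_continuous v"
    and ineq: "\<Phi> (v t) - \<Phi> (v s) \<le> - (ereal (1/2) * enn2ereal ?A) - (ereal (1/2) * enn2ereal ?B)"
  proof -
    show "v s \<in> dom_fun \<Phi>" "v t \<in> dom_fun \<Phi>" "locally_abs_continuous v"
      using v st unfolding gradient_flow_def by auto
    have "0 < t" using st by simp
    with v st(1) have "\<Phi> (v t) - \<Phi> (v s) \<le>
          - (ereal (1/2) * oriented_nn_integral (\<lambda>r. (ennreal (metric_derivative v r))\<^sup>2) s t)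
          - (ereal (1/2) * oriented_nn_integral (\<lambda>r. (e2ennreal (g (v r)))\<^sup>2) s t)"
      unfolding gradient_flow_def by blast
    then show "\<Phi> (v t) - \<Phi> (v s) \<le> - (ereal (1/2) * enn2ereal ?A) - (ereal (1/2) * enn2ereal ?B)"
      unfolding oriented_nn_integral_def if_P[OF st(2)] .
  qed
  obtain p where p: "\<Phi> (v s) = ereal p" using dom(1) fin[of "v s"] by (cases "\<Phi> (v s)") (auto simp: dom_fun_def)
  obtain q where q: "\<Phi> (v t) = ereal q" using dom(2) fin[of "v t"] by (cases "\<Phi> (v t)") (auto simp: dom_fun_def)
  \<comment> \<open>An infinite integral would push the right-hand side to minus infinity, whereas
    the energy difference is real.\<close>
  obtain \<alpha> \<beta> where ab: "?A = ennreal \<alpha>" "0 \<le> \<alpha>" "?B = ennreal \<beta>" "0 \<le> \<beta>"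
    using ineq by (cases ?A; cases ?B) (auto simp: p q)
  from ineq have drop: "q + \<alpha> / 2 + \<beta> / 2 \<le> p" unfolding ab(1,3) p q
    by (simp add: ab(2,4) enn2ereal_ennreal)
  have ne: "AE r in lebesgue. r \<noteq> t"
    by (intro AE_not_in[of "{t}", simplified]) (simp flip: negligible_iff_null_sets)
  have const: "(\<integral>\<^sup>+r\<in>{s..t}. ennreal (c\<^sup>2) \<partial>lebesgue) = ennreal (c\<^sup>2 * (t - s))"
    using st by (simp add: nn_integral_cmult_indicator ennreal_mult)
  have "(\<integral>\<^sup>+r\<in>{s..t}. ennreal (c\<^sup>2) \<partial>lebesgue) \<le> ?B"
  proof (rule nn_integral_mono_AE)
    show "AE r in lebesgue. ennreal (c\<^sup>2) * indicator {s..t} r \<le> (e2ennreal (g (v r)))\<^sup>2 * indicator {s..t} r"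
      using ne
    proof eventually_elim
      case (elim r)
      show ?case
      proof (cases "r \<in> {s..t}")
        case True
        with elim g[of r] have "e2ennreal (ereal c) \<le> e2ennreal (g (v r))" by (intro e2ennreal_mono) auto
        then have "(ennreal c)\<^sup>2 \<le> (e2ennreal (g (v r)))\<^sup>2"
          by (intro power_mono) (auto simp: e2ennreal_ereal)
        with True \<open>0 \<le> c\<close> show ?thesis by (simp add: ennreal_power)
      qed simp
    qed
  qed
  then have beta: "c\<^sup>2 * (t - s) \<le> \<beta>" unfolding const ab(3) using ab(4) by (simp add: ennreal_le_iff)
  with drop ab(2) show "\<Phi> (v t) + ereal (c\<^sup>2 / 2 * (t - s)) \<le> \<Phi> (v s)"
    unfolding p q by simp
  obtain D :: "real \<Rightarrow> real" where D: "D \<in> borel_measurable borel" "\<And>r. 0 \<le> D r"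
    "AE r in lebesgue. r \<in> {s..t} \<longrightarrow> metric_derivative v r = D r"
    "ennreal (dist (v s) (v t)) \<le> (\<integral>\<^sup>+r\<in>{s..t}. ennreal (D r) \<partial>lebesgue)"
    using locally_abs_continuous_metric_derivative[OF lac st] by blast
  have D_meas: "D \<in> borel_measurable lebesgue" by (rule measurable_completion) (use D in simp)
  have "?A = (\<integral>\<^sup>+r\<in>{s..t}. ennreal ((D r)\<^sup>2) \<partial>lebesgue)"
    by (rule nn_integral_cong_AE, use D(3) in eventually_elim) (auto simp: ennreal_power D(2) split: split_indicator)
  \<comment> \<open>The second integrand is the constant \<open>c\<^sup>2\<close> instead of the
    squared slope, whose measurability is unknown; both summands are then measurable.\<close>
  then have sum: "(\<integral>\<^sup>+r\<in>{s..t}. ennreal ((D r)\<^sup>2) \<partial>lebesgue) + (\<integral>\<^sup>+r\<in>{s..t}. ennreal (c\<^sup>2) \<partial>lebesgue) =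
      ennreal (\<alpha> + c\<^sup>2 * (t - s))"
    unfolding const ab(1)[symmetric] using ab st by (simp add: ennreal_plus)
  have "ennreal (2 * c * dist (v s) (v t)) = ennreal (2 * c) * ennreal (dist (v s) (v t))"
    using \<open>0 \<le> c\<close> by (simp add: ennreal_mult)
  also have "\<dots> \<le> ennreal (2 * c) * (\<integral>\<^sup>+r\<in>{s..t}. ennreal (D r) \<partial>lebesgue)"
    by (rule mult_left_mono[OF D(4)]) simp
  also have "\<dots> = (\<integral>\<^sup>+r. ennreal (2 * c) * (ennreal (D r) * indicator {s..t} r) \<partial>lebesgue)"
    by (rule nn_integral_cmult[symmetric])
      (intro borel_measurable_times_ennreal borel_measurable_indicator measurable_compose[OF D_meas measurable_ennreal]; simp)
  also have "\<dots> \<le> (\<integral>\<^sup>+r. ennreal ((D r)\<^sup>2) * indicator {s..t} r + ennreal (c\<^sup>2) * indicator {s..t} r \<partial>lebesgue)"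
  proof (rule nn_integral_mono)
    fix r :: real
    have "2 * c * D r \<le> (D r)\<^sup>2 + c\<^sup>2" using sum_squares_bound[of c "D r"] by (simp add: add.commute)
    then have "ennreal (2 * c * D r) \<le> ennreal ((D r)\<^sup>2 + c\<^sup>2)" by (rule ennreal_leI)
    then show "ennreal (2 * c) * (ennreal (D r) * indicator {s..t} r)
         \<le> ennreal ((D r)\<^sup>2) * indicator {s..t} r + ennreal (c\<^sup>2) * indicator {s..t} r"
      using \<open>0 \<le> c\<close> D(2)[of r] by (auto simp: ennreal_mult ennreal_plus split: split_indicator)
  qed
  also have "\<dots> = ennreal (\<alpha> + c\<^sup>2 * (t - s))"
    unfolding sum[symmetric] by (rule nn_integral_add)
      (intro borel_measurable_times_ennreal borel_measurable_indicator measurable_compose[OF _ measurable_ennreal]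
        borel_measurable_power D_meas borel_measurable_const; simp)+
  finally have "ennreal (2 * c * dist (v s) (v t)) \<le> ennreal (\<alpha> + c\<^sup>2 * (t - s))" .
  moreover have "0 \<le> \<alpha> + c\<^sup>2 * (t - s)" using ab st by simp
  ultimately have "2 * c * dist (v s) (v t) \<le> \<alpha> + c\<^sup>2 * (t - s)" by (simp only: ennreal_le_iff)
  with drop beta show "\<Phi> (v t) + ereal (c * dist (v s) (v t)) \<le> \<Phi> (v s)"
    unfolding p q by simp
qed

lemma gradient_flow_restart:
  assumes v: "gradient_flow \<Phi> g v" and fin: "\<And>x. \<Phi> x \<noteq> -\<infinity>" and lsc: "lower_semicontinuous \<Phi>"
    and g: "\<And>x. 0 \<le> g x" and "0 < T"
  shows "v T \<in> flow_starting_points \<Phi> g"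
proof -
  have dom: "v T \<in> dom_fun \<Phi>" and lac: "locally_abs_continuous v"
    using v \<open>0 < T\<close> by (auto simp: gradient_flow_def)
  have "isCont v T" using lac \<open>0 < T\<close> by (rule locally_abs_continuous_imp_isCont)
  then have lim: "((\<lambda>h. v (T + h)) \<longlongrightarrow> v T) (at_right 0)"
    unfolding isCont_iff by (rule filterlim_mono) (auto simp: at_le)
  have "((\<lambda>h. \<Phi> (v (T + h))) \<longlongrightarrow> \<Phi> (v T)) (at_right 0)"
  proof (rule order_tendstoI)
    fix y assume "y < \<Phi> (v T)"
    then have "eventually (\<lambda>x. y < \<Phi> x) (nhds (v T))" using lsc by (simp add: lower_semicontinuous_def)
    with lim show "eventually (\<lambda>h. y < \<Phi> (v (T + h))) (at_right 0)"
      unfolding filterlim_iff by blast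
  next
    fix y assume y: "\<Phi> (v T) < y"
    have "\<Phi> (v (T + h)) < y" if "h > 0" for h
    proof -
      \<comment> \<open>Monotonicity of the energy is the case \<open>c = 0\<close> of the energy
        drop.\<close>
      have "\<Phi> (v (T + h)) \<le> \<Phi> (v T)"
        using gradient_flow_energy_drop(1)[OF v fin \<open>0 < T\<close>, of "T + h" 0] that g by (simp add: zero_ereal_def[symmetric])
      with y show ?thesis by simp
    qed
    then show "eventually (\<lambda>h. \<Phi> (v (T + h)) < y) (at_right 0)"
      by (intro eventually_at_rightI[of 0 1]) auto
  qed
  with dom lim gradient_flow_shift[OF v] \<open>0 < T\<close> show ?thesis
    by (auto simp: flow_starting_points_def intro!: exI[of _ "\<lambda>t. v (T + t)"])
qed

section \<open>Ekeland points and the global slope\<close>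

lemma global_slope_nonneg: "0 \<le> global_slope \<Phi> x"
  by (simp add: global_slope_def)

text \<open>For \<open>c \<ge> 0\<close> and \<open>\<Phi>\<close> avoiding minus infinity, a point
  of the domain belongs to this set exactly when its global slope is at most \<open>c\<close>. The
  additive form avoids quotients and differences of infinite values.\<close>

definition ekeland_points :: "('a::metric_space \<Rightarrow> ereal) \<Rightarrow> real \<Rightarrow> 'a set" where
  "ekeland_points \<Phi> c = {x. \<forall>z. \<Phi> x \<le> \<Phi> z + ereal (c * dist z x)}"

text \<open>A competitor \<open>z\<close> that violates the inequality at \<open>x\<close> does so
  at all nearby points: a real \<open>\<gamma>\<close> strictly between the two sides separates
  them, by continuity of the distance and lower semicontinuity of \<open>\<Phi>\<close>.\<close>

lemma closed_ekeland_points: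
  fixes \<Phi> :: "'a::metric_space \<Rightarrow> ereal"
  assumes fin: "\<And>x. \<Phi> x \<noteq> -\<infinity>" and lsc: "lower_semicontinuous \<Phi>"
  shows "closed (ekeland_points \<Phi> c)"
  unfolding closed_def
proof (subst open_subopen, intro ballI)
  fix x assume "x \<in> - ekeland_points \<Phi> c"
  then obtain z where z: "\<Phi> z + ereal (c * dist z x) < \<Phi> x"
    by (auto simp: ekeland_points_def not_le)
  then obtain p where p: "\<Phi> z = ereal p" using fin[of z] by (cases "\<Phi> z") auto
  obtain \<gamma> where \<gamma>: "p + c * dist z x < \<gamma>" "ereal \<gamma> < \<Phi> x"
    using z ereal_dense2[of "\<Phi> z + ereal (c * dist z x)" "\<Phi> x"] p by auto
  have "eventually (\<lambda>y. ereal \<gamma> < \<Phi> y) (nhds x)" using lsc \<gamma> by (simp add: lower_semicontinuous_def)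
  moreover have "((\<lambda>y. p + c * dist z y) \<longlongrightarrow> p + c * dist z x) (nhds x)"
    by (intro tendsto_intros filterlim_ident)
  then have "eventually (\<lambda>y. p + c * dist z y < \<gamma>) (nhds x)" using \<gamma>(1) by (rule order_tendstoD)
  ultimately have "eventually (\<lambda>y. y \<in> - ekeland_points \<Phi> c) (nhds x)"
  proof eventually_elim
    case (elim y)
    then have "\<Phi> z + ereal (c * dist z y) < \<Phi> y" unfolding p by (simp add: less_trans[of _ "ereal \<gamma>"])
    then show ?case by (auto simp: ekeland_points_def not_le)
  qed
  then show "\<exists>S. open S \<and> x \<in> S \<and> S \<subseteq> - ekeland_points \<Phi> c"
    unfolding eventually_nhds by blast
qed

text \<open>The competitor \<open>z\<close> violating the inequality has a difference quotient above
  \<open>c\<close> in the supremum.\<close>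

lemma global_slope_ge_outside_ekeland_points:
  fixes \<Phi> :: "'a::metric_space \<Rightarrow> ereal"
  assumes fin: "\<And>x. \<Phi> x \<noteq> -\<infinity>" and x: "x \<notin> ekeland_points \<Phi> c" "x \<in> dom_fun \<Phi>"
  shows "ereal c \<le> global_slope \<Phi> x"
proof -
  obtain z where z: "\<Phi> z + ereal (c * dist z x) < \<Phi> x"
    using x by (auto simp: ekeland_points_def not_le)
  then obtain p where p: "\<Phi> z = ereal p" using fin[of z] by (cases "\<Phi> z") auto
  obtain q where q: "\<Phi> x = ereal q" using x fin[of x] by (cases "\<Phi> x") (auto simp: dom_fun_def)
  have "z \<noteq> x" using z p q by auto
  then have "dist x z > 0" by simp
  have "ereal c \<le> (\<Phi> x - \<Phi> z) / ereal (dist x z)"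
    using z \<open>dist x z > 0\<close> by (simp add: p q pos_le_divide_eq dist_commute)
  also have "\<dots> \<le> (SUP v\<in>UNIV - {x}. (\<Phi> x - \<Phi> v) / ereal (dist x v))"
    by (rule SUP_upper) (use \<open>z \<noteq> x\<close> in auto)
  finally show ?thesis using x by (simp add: global_slope_def le_max_iff_disj)
qed

theorem corollary2p10:
  fixes \<Phi> :: "'a::metric_space \<Rightarrow> ereal" and u :: 'a and \<epsilon> :: real
  assumes "\<And>x. \<Phi> x \<noteq> -\<infinity>"
    and "proper \<Phi>"
    and "\<exists>c::real. \<forall>x. ereal c \<le> \<Phi> x"
    and "lower_semicontinuous \<Phi>"
    and "flow_starting_points \<Phi> (global_slope \<Phi>) \<noteq> {}"
    and "u \<in> flow_starting_points \<Phi> (global_slope \<Phi>)"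
    and "\<epsilon> > 0"
    and "\<Phi> u \<le> (INF x. \<Phi> x) + ereal \<epsilon>"
  shows "\<forall>l::real. l > 0 \<longrightarrow>
    (\<exists>u' \<in> flow_starting_points \<Phi> (global_slope \<Phi>).
       dist u u' \<le> l \<and>
       \<Phi> u' + ereal (\<epsilon> / l * dist u u') \<le> \<Phi> u \<and>
       (\<forall>v. \<Phi> u' \<le> \<Phi> v + ereal (\<epsilon> / l * dist v u')))"
proof (intro allI impI)
  fix l :: real assume "l > 0"
  note fin = assms(1) and lsc = assms(4)
  define c where "c = \<epsilon> / l"
  have "c > 0" using \<open>\<epsilon> > 0\<close> \<open>l > 0\<close> by (simp add: c_def)
  let ?g = "global_slope \<Phi>"
  let ?C = "ekeland_points \<Phi> c"
  have closed: "closed ?C" by (rule closed_ekeland_points[OF fin lsc])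
  have "\<exists>u' \<in> flow_starting_points \<Phi> ?g. \<Phi> u' + ereal (c * dist u u') \<le> \<Phi> u \<and> u' \<in> ?C"
  proof (cases "u \<in> ?C")
    case True
    with assms(6) show ?thesis by (intro bexI[of _ u]) auto
  next
    case False
    obtain v where v: "gradient_flow \<Phi> ?g v" and v0: "(v \<longlongrightarrow> u) (at_right 0)"
      and \<Phi>0: "((\<lambda>t. \<Phi> (v t)) \<longlongrightarrow> \<Phi> u) (at_right 0)"
      using assms(6) by (auto simp: flow_starting_points_def)
    have dom: "v t \<in> dom_fun \<Phi>" if "t > 0" for t using v that by (auto simp: gradient_flow_def)
    have slope: "ereal c \<le> ?g (v t)" if "t > 0" "v t \<notin> ?C" for t
      using global_slope_ge_outside_ekeland_points[where \<Phi> = \<Phi>, OF fin] that dom by blast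
    have "eventually (\<lambda>t. v t \<in> - ?C) (at_right 0)"
      using topological_tendstoD[OF v0, of "- ?C"] closed False by auto
    \<comment> \<open>The flow has no value at time \<open>0\<close>. A start-up interval free of
      \<open>?C\<close> lets the first hitting time be sought in the compact interval
      \<open>{\<tau>..t1}\<close>.\<close>
    then obtain \<tau> where \<tau>: "\<tau> > 0" "\<And>t. \<lbrakk>0 < t; t < \<tau>\<rbrakk> \<Longrightarrow> v t \<notin> ?C"
      by (auto simp: eventually_at_right_field)
    have "\<exists>t>0. v t \<in> ?C"
    proof (rule ccontr)
      assume "\<not> ?thesis"
      then have drop: "\<Phi> (v t) + ereal (c\<^sup>2 / 2 * (t - 1)) \<le> \<Phi> (v 1)" if "1 \<le> t" for t
        using gradient_flow_energy_drop(1)[OF v fin, of 1 t c] slope that \<open>c > 0\<close> by auto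
      obtain k where k: "\<And>x. ereal k \<le> \<Phi> x" using assms(3) by blast
      obtain p where p: "\<Phi> (v 1) = ereal p" using dom[of 1] fin[of "v 1"] by (cases "\<Phi> (v 1)") (auto simp: dom_fun_def)
      have "k \<le> p" using k[of "v 1"] p by simp
      \<comment> \<open>At this time the guaranteed drop is \<open>p - k + 1\<close>, more than the
        energy \<open>p - k\<close> available above the lower bound.\<close>
      define t where "t = 1 + 2 * (p - k + 1) / c\<^sup>2"
      have "1 \<le> t" using \<open>k \<le> p\<close> by (simp add: t_def)
      have "ereal k + ereal (c\<^sup>2 / 2 * (t - 1)) \<le> \<Phi> (v t) + ereal (c\<^sup>2 / 2 * (t - 1))"
        by (intro add_right_mono k)
      also have "\<dots> \<le> ereal p" using drop[OF \<open>1 \<le> t\<close>] p by simp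
      finally have "k + c\<^sup>2 / 2 * (t - 1) \<le> p" by simp
      moreover have "c\<^sup>2 / 2 * (t - 1) = p - k + 1" using \<open>c > 0\<close> by (simp add: t_def)
      ultimately show False by simp
    qed
    then obtain t1 where t1: "t1 > 0" "v t1 \<in> ?C" by blast
    have lac: "locally_abs_continuous v" using v by (simp add: gradient_flow_def)
    have "\<tau> \<le> t1" using \<tau>(2)[of t1] t1 by (meson not_le)
    let ?S = "{\<tau>..t1} \<inter> v -` ?C"
    have "continuous_on {\<tau>..t1} v"
      using locally_abs_continuous_imp_isCont[OF lac] \<tau>(1) by (intro continuous_at_imp_continuous_on) auto
    then have "closed ?S" by (rule continuous_closed_preimage) (use closed in auto)
    then have "compact ?S" using compact_Icc[of \<tau> t1] by (metis closed_Int_compact compact_Int_closed inf_left_idem)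
    moreover have "t1 \<in> ?S" using t1 \<open>\<tau> \<le> t1\<close> by simp
    ultimately obtain T where T: "T \<in> ?S" and min: "\<And>t. t \<in> ?S \<Longrightarrow> T \<le> t"
      by (metis compact_attains_inf empty_iff)
    have "T > 0" using T \<tau>(1) by simp
    have before: "v t \<notin> ?C" if "0 < t" "t < T" for t
      using \<tau>(2)[of t] min[of t] that T by (cases "t < \<tau>") auto
    obtain q where q: "\<Phi> (v T) = ereal q"
      using dom[OF \<open>T > 0\<close>] fin[of "v T"] by (cases "\<Phi> (v T)") (auto simp: dom_fun_def)
    have "\<Phi> (v T) + ereal (c * dist u (v T)) \<le> \<Phi> u"
    \<comment> \<open>The energy drop is known from positive times \<open>s\<close> only;
      convergence of both curve and energy as \<open>s\<close> decreases to \<open>0\<close> carries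
      it to \<open>u\<close>.\<close>
    proof (rule tendsto_le[OF _ \<Phi>0])
      show "((\<lambda>s. \<Phi> (v T) + ereal (c * dist (v s) (v T))) \<longlongrightarrow> \<Phi> (v T) + ereal (c * dist u (v T))) (at_right 0)"
        unfolding q plus_ereal.simps by (intro tendsto_intros v0)
      have "\<Phi> (v T) + ereal (c * dist (v s) (v T)) \<le> \<Phi> (v s)" if "0 < s" "s < T" for s
        using gradient_flow_energy_drop(2)[OF v fin, of s T c] slope before that \<open>c > 0\<close> by auto
      then show "eventually (\<lambda>s. \<Phi> (v T) + ereal (c * dist (v s) (v T)) \<le> \<Phi> (v s)) (at_right 0)"
        using \<open>T > 0\<close> by (intro eventually_at_rightI[of 0 T]) auto
    qed simp
    moreover have "v T \<in> flow_starting_points \<Phi> ?g"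
      by (rule gradient_flow_restart[OF v fin lsc global_slope_nonneg \<open>T > 0\<close>])
    ultimately show ?thesis using T by blast
  qed
  then obtain u' where u': "u' \<in> flow_starting_points \<Phi> ?g"
    "\<Phi> u' + ereal (c * dist u u') \<le> \<Phi> u" "u' \<in> ?C" by blast
  have "dist u u' \<le> l"
  proof -
    \<comment> \<open>Almost minimality allows the energy to fall by at most
      \<open>\<epsilon> = c * l\<close> from \<open>u\<close> to \<open>u'\<close>, which bounds the
      distance.\<close>
    have "(INF x. \<Phi> x) \<le> \<Phi> u'" by (rule INF_lower) simp
    then have "\<Phi> u \<le> \<Phi> u' + ereal \<epsilon>" using assms(8) by (meson add_right_mono order_trans)
    with u'(2) have "\<Phi> u' + ereal (c * dist u u') \<le> \<Phi> u' + ereal \<epsilon>" by (rule order_trans)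
    moreover have "u' \<in> dom_fun \<Phi>" using u'(1) by (simp add: flow_starting_points_def)
    ultimately have "c * dist u u' \<le> \<epsilon>" using fin[of u'] by (cases "\<Phi> u'") (auto simp: dom_fun_def)
    then show ?thesis using \<open>\<epsilon> > 0\<close> \<open>l > 0\<close> by (simp add: c_def field_simps)
  qed
  with u' show "\<exists>u' \<in> flow_starting_points \<Phi> ?g. dist u u' \<le> l \<and>
       \<Phi> u' + ereal (\<epsilon> / l * dist u u') \<le> \<Phi> u \<and> (\<forall>v. \<Phi> u' \<le> \<Phi> v + ereal (\<epsilon> / l * dist v u'))"
    by (auto simp: ekeland_points_def c_def)
qed

end
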